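(* Let $\mathcal A\in\mathbb C^{m\times n\times p}$ be a tensor, let $f:\mathbb C\to\mathbb C$ be a scalar function, and let $f^{\Diamond}:\mathbb C^{m\times n\times p}\to\mathbb C^{m\times n\times p}$ be the corresponding generalized function of third order tensors, assumed to be well defined at $\mathcal A$. (1) If $\mathcal A$ is centrohermitian (respectively skew-centrohermitian), then $f^{\Diamond}(\mathcal A)$ is also centrohermitian (respectively skew-centrohermitian). (2) If $m=n$ and $\mathcal A$ is normal, i.e. $\mathcal A^H*\mathcal A=\mathcal A*\mathcal A^H$, then $f^{\Diamond}(\mathcal A)$ is also normal. (3) If $m=n$ and $\mathcal A$ is F-circulant, then $f^{\Diamond}(\mathcal A)$ is also F-circulant. (4) If $\mathcal A$ is an F-block-circulant tensor with F-circulant blocks, then $f^{\Diamond}(\mathcal A)$ is also an F-block-circulant tensor with F-circulant blocks.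
   Context: T-product. For $\mathcal A\in\mathbb C^{m\times n\times p}$ with frontal slices $A^{(1)},\dots,A^{(p)}\in\mathbb C^{m\times n}$, $\mathrm{unfold}(\mathcal A)\in\mathbb C^{mp\times n}$ is the vertical stack of $A^{(1)},\dots,A^{(p)}$, $\mathrm{fold}$ is its inverse, and $\mathrm{bcirc}(\mathcal A)\in\mathbb C^{mp\times np}$ is the block circulant matrix whose $(a,b)$ block is $A^{(((a-b)\bmod p)+1)}$; $\mathrm{bcirc}^{-1}$ is the inverse of $\mathrm{bcirc}$ on its image. For $\mathcal B\in\mathbb C^{n\times s\times p}$, $\mathcal A*\mathcal B=\mathrm{fold}(\mathrm{bcirc}(\mathcal A)\,\mathrm{unfold}(\mathcal B))$. $\mathcal A^H$ is obtained by conjugate transposing each frontal slice and reversing the order of slices $2,\dots,p$; $\overline{\mathcal A}$ is the entrywise conjugate. The identity tensor has first frontal slice the identity matrix and other slices zero; $\mathcal Q$ is unitary if $\mathcal Q^H*\mathcal Q=\mathcal Q*\mathcal Q^H$ is the identity tensor. Generalized tensor function. $F_p=p^{-1/2}(\omega^{jk})_{j,k=0}^{p-1}$ with $\omega=e^{-2\pi\mathbf i/p}$. A T-SVD is $\mathcal A=\mathcal U*\mathcal S*\mathcal V^H$ with $\mathcal U,\mathcal V$ unitary, $\mathcal S$ F-diagonal (every frontal slice diagonal) and $\mathrm{bcirc}(\mathcal S)=(F_p\otimes I_m)\mathrm{diag}(\Sigma_1,\dots,\Sigma_p)(F_p^H\otimes I_n)$, where each $\Sigma_i\in\mathbb R^{m\times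 n}$ is diagonal with nonnegative entries. For a scalar function $f$, $f^{\Diamond}(\mathcal A)=\mathcal U*\hat f(\mathcal S)*\mathcal V^H$ with $\hat f(\mathcal S)=\mathrm{bcirc}^{-1}\big((F_p\otimes I_m)\mathrm{diag}(\tilde f(\Sigma_1),\dots,\tilde f(\Sigma_p))(F_p^H\otimes I_n)\big)$ and $\tilde f(\Sigma_i)=f(\sqrt{\Sigma_i\Sigma_i^H})(\sqrt{\Sigma_i\Sigma_i^H})^\dagger\Sigma_i$, i.e. $\tilde f(\Sigma_i)$ is diagonal, with $f(\sigma)$ in place of each diagonal entry $\sigma>0$ and $0$ in place of each diagonal entry $0$. Structures. $\mathcal R_n\in\mathbb R^{n\times n\times p}$ has first frontal slice the $n\times n$ matrix with ones on the antidiagonal and zeros elsewhere, and other slices zero. $\mathcal A\in\mathbb C^{m\times n\times p}$ is centrohermitian if $\mathcal R_m*\mathcal A*\mathcal R_n=\overline{\mathcal A}$ and skew-centrohermitian if $\mathcal R_m*\mathcal A*\mathcal R_n=-\overline{\mathcal A}$. The prefix "F-" means that the property holds for every frontal slice: $\mathcal A$ is F-circulant if every frontal slice is a circulant matrix, and F-block-circulant with F-circulant blocks if every frontal slice is a block circulant matrix with circulant blocks.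
   Formalization: Part (1) additionally assumes that f is real at the positive diagonal entries of the Σ_i of A; without this it fails (m=n=p=1, A=1, f constant i), and the condition is necessary for the conclusion. *)

theory Defs
  imports Complex_Main "Jordan_Normal_Form.Schur_Decomposition"
begin

text \<open>
  A third order tensor is the list of its frontal slices. All slice indices are 0-based, so
  \<open>A ! 0\<close> is the first frontal slice.
\<close>

type_synonym tensor = "complex mat list"

definition tensor_carrier :: "nat \<Rightarrow> nat \<Rightarrow> nat \<Rightarrow> tensor set" where
  "tensor_carrier m n p = {A. length A = p \<and> set A \<subseteq> carrier_mat m n}"


subsection \<open>The T-product\<close>

definition t_unfold :: "tensor \<Rightarrow> complex mat" where
  "t_unfold A = (let m = dim_row (A ! 0); n = dim_col (A ! 0) in
     mat (m * length A) n (\<lambda>(i, j). A ! (i div m) $$ (i mod m, j)))"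

definition t_fold :: "nat \<Rightarrow> complex mat \<Rightarrow> tensor" where
  "t_fold p M = (let m = dim_row M div p in
     map (\<lambda>k. mat m (dim_col M) (\<lambda>(i, j). M $$ (k * m + i, j))) [0..<p])"

text \<open>
  The summand \<open>p\<close> only avoids truncated subtraction: for \<open>b < p\<close> the number
  \<open>(a + p - b) mod p\<close> is the residue of \<open>a - b\<close>.
\<close>

definition bcirc :: "tensor \<Rightarrow> complex mat" where
  "bcirc A = (let m = dim_row (A ! 0); n = dim_col (A ! 0); p = length A in
     mat (m * p) (n * p)
       (\<lambda>(i, j). A ! ((i div m + p - j div n) mod p) $$ (i mod m, j mod n)))"

definition bcirc_inv :: "nat \<Rightarrow> nat \<Rightarrow> nat \<Rightarrow> complex mat \<Rightarrow> tensor" where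
  "bcirc_inv m n p = inv_into (tensor_carrier m n p) bcirc"

definition t_prod :: "tensor \<Rightarrow> tensor \<Rightarrow> tensor" (infixl "*\<^sub>T" 70) where
  "A *\<^sub>T B = t_fold (length A) (bcirc A * t_unfold B)"

definition t_adjoint :: "tensor \<Rightarrow> tensor" where
  "t_adjoint A = (let p = length A in map (\<lambda>k. mat_adjoint (A ! ((p - k) mod p))) [0..<p])"

definition t_cnj :: "tensor \<Rightarrow> tensor" where
  "t_cnj A = map (map_mat cnj) A"

definition t_uminus :: "tensor \<Rightarrow> tensor" where
  "t_uminus A = map uminus A"

definition t_id :: "nat \<Rightarrow> nat \<Rightarrow> tensor" where
  "t_id n p = 1\<^sub>m n # replicate (p - 1) (0\<^sub>m n n)"

definition t_unitary :: "nat \<Rightarrow> nat \<Rightarrow> tensor \<Rightarrow> bool" where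
  "t_unitary n p Q \<longleftrightarrow> Q \<in> tensor_carrier n n p \<and>
     t_adjoint Q *\<^sub>T Q = t_id n p \<and> Q *\<^sub>T t_adjoint Q = t_id n p"

definition F_diagonal :: "tensor \<Rightarrow> bool" where
  "F_diagonal S \<longleftrightarrow> (\<forall>M \<in> set S. diagonal_mat M)"


subsection \<open>T-SVD and generalized tensor functions\<close>

definition kron :: "complex mat \<Rightarrow> complex mat \<Rightarrow> complex mat" (infixl "\<otimes>\<^sub>K" 75) where
  "A \<otimes>\<^sub>K B = mat (dim_row A * dim_row B) (dim_col A * dim_col B)
     (\<lambda>(i, j). A $$ (i div dim_row B, j div dim_col B) * B $$ (i mod dim_row B, j mod dim_col B))"

definition dft_mat :: "nat \<Rightarrow> complex mat" where
  "dft_mat p = mat p p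
     (\<lambda>(j, k). exp (- (2 * of_real pi * \<i> / of_nat p)) ^ (j * k) / of_real (sqrt (real p)))"

definition fourier_block_diag :: "nat \<Rightarrow> nat \<Rightarrow> nat \<Rightarrow> complex mat list \<Rightarrow> complex mat" where
  "fourier_block_diag m n p Ds =
     (dft_mat p \<otimes>\<^sub>K 1\<^sub>m m) * diag_block_mat Ds * (mat_adjoint (dft_mat p) \<otimes>\<^sub>K 1\<^sub>m n)"

definition t_svd :: "nat \<Rightarrow> nat \<Rightarrow> nat \<Rightarrow> tensor \<Rightarrow> tensor \<Rightarrow> tensor \<Rightarrow> tensor \<Rightarrow> real mat list \<Rightarrow> bool"
where
  "t_svd m n p A U S V \<Sigma>s \<longleftrightarrow>
     t_unitary m p U \<and> t_unitary n p V \<and>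
     S \<in> tensor_carrier m n p \<and> F_diagonal S \<and>
     A = U *\<^sub>T S *\<^sub>T t_adjoint V \<and>
     length \<Sigma>s = p \<and>
     (\<forall>\<Sigma> \<in> set \<Sigma>s. \<Sigma> \<in> carrier_mat m n \<and> diagonal_mat \<Sigma> \<and> (\<forall>i<m. \<forall>j<n. 0 \<le> \<Sigma> $$ (i, j))) \<and>
     bcirc S = fourier_block_diag m n p (map (map_mat complex_of_real) \<Sigma>s)"

text \<open>On a nonnegative diagonal matrix, replace each positive entry by its image under \<open>f\<close>.\<close>

definition f_tilde :: "(complex \<Rightarrow> complex) \<Rightarrow> real mat \<Rightarrow> complex mat" where
  "f_tilde f \<Sigma> = map_mat (\<lambda>\<sigma>. if 0 < \<sigma> then f (complex_of_real \<sigma>) else 0) \<Sigma>"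

definition f_hat :: "nat \<Rightarrow> nat \<Rightarrow> nat \<Rightarrow> (complex \<Rightarrow> complex) \<Rightarrow> real mat list \<Rightarrow> tensor" where
  "f_hat m n p f \<Sigma>s = bcirc_inv m n p (fourier_block_diag m n p (map (f_tilde f) \<Sigma>s))"

text \<open>
  A T-SVD of \<open>A\<close> is not unique. The generalized function is well defined at \<open>A\<close> if the
  T-SVDs of \<open>A\<close> yield exactly one value.
\<close>

definition gen_fun_value ::
  "nat \<Rightarrow> nat \<Rightarrow> nat \<Rightarrow> (complex \<Rightarrow> complex) \<Rightarrow> tensor \<Rightarrow> tensor \<Rightarrow> bool" where
  "gen_fun_value m n p f A B \<longleftrightarrow>
     (\<exists>U S V \<Sigma>s. t_svd m n p A U S V \<Sigma>s \<and> B = U *\<^sub>T f_hat m n p f \<Sigma>s *\<^sub>T t_adjoint V)"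

definition gen_fun_well_defined ::
  "nat \<Rightarrow> nat \<Rightarrow> nat \<Rightarrow> (complex \<Rightarrow> complex) \<Rightarrow> tensor \<Rightarrow> bool" where
  "gen_fun_well_defined m n p f A \<longleftrightarrow> (\<exists>!B. gen_fun_value m n p f A B)"

definition gen_fun :: "nat \<Rightarrow> nat \<Rightarrow> nat \<Rightarrow> (complex \<Rightarrow> complex) \<Rightarrow> tensor \<Rightarrow> tensor" where
  "gen_fun m n p f A = (THE B. gen_fun_value m n p f A B)"

text \<open>
  The diagonal entries of the matrices \<open>\<Sigma>\<^sub>1, \<dots>, \<Sigma>\<^sub>p\<close> of the T-SVDs of \<open>A\<close>. Preservation of
  (skew-)centrohermitian structure involves entrywise conjugation, and so needs \<open>f\<close> to be real on
  the positive ones: for the \<open>1 \<times> 1 \<times> 1\<close> tensor \<open>1\<close>, which is centrohermitian, and the constant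
  function \<open>f = \<i>\<close>, the value is \<open>\<i>\<close>, which is not.
\<close>

definition t_singular_values :: "nat \<Rightarrow> nat \<Rightarrow> nat \<Rightarrow> tensor \<Rightarrow> real set" where
  "t_singular_values m n p A =
     {\<Sigma> $$ (i, i) | \<Sigma> i. \<exists>U S V \<Sigma>s. t_svd m n p A U S V \<Sigma>s \<and> \<Sigma> \<in> set \<Sigma>s \<and> i < min m n}"


subsection \<open>Structured tensors\<close>

definition t_exchange :: "nat \<Rightarrow> nat \<Rightarrow> tensor" where
  "t_exchange n p =
     mat n n (\<lambda>(i, j). if i + j + 1 = n then 1 else 0) # replicate (p - 1) (0\<^sub>m n n)"

definition centrohermitian :: "nat \<Rightarrow> nat \<Rightarrow> nat \<Rightarrow> tensor \<Rightarrow> bool" where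
  "centrohermitian m n p A \<longleftrightarrow>
     A \<in> tensor_carrier m n p \<and> t_exchange m p *\<^sub>T A *\<^sub>T t_exchange n p = t_cnj A"

definition skew_centrohermitian :: "nat \<Rightarrow> nat \<Rightarrow> nat \<Rightarrow> tensor \<Rightarrow> bool" where
  "skew_centrohermitian m n p A \<longleftrightarrow>
     A \<in> tensor_carrier m n p \<and> t_exchange m p *\<^sub>T A *\<^sub>T t_exchange n p = t_uminus (t_cnj A)"

definition t_normal :: "nat \<Rightarrow> nat \<Rightarrow> tensor \<Rightarrow> bool" where
  "t_normal n p A \<longleftrightarrow>
     A \<in> tensor_carrier n n p \<and> t_adjoint A *\<^sub>T A = A *\<^sub>T t_adjoint A"

definition circulant_mat :: "nat \<Rightarrow> complex mat \<Rightarrow> bool" where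
  "circulant_mat n C \<longleftrightarrow> C \<in> carrier_mat n n \<and>
     (\<exists>c. \<forall>i<n. \<forall>j<n. C $$ (i, j) = c ((i + n - j) mod n))"

text \<open>An \<open>N \<times> N\<close> grid of \<open>k \<times> k\<close> blocks; circulant blocks are square, hence so is the matrix.\<close>

definition block_circulant_circulant_blocks :: "nat \<Rightarrow> nat \<Rightarrow> complex mat \<Rightarrow> bool" where
  "block_circulant_circulant_blocks N k M \<longleftrightarrow> M \<in> carrier_mat (N * k) (N * k) \<and>
     (\<exists>B. (\<forall>r<N. circulant_mat k (B r)) \<and>
          (\<forall>a<N. \<forall>b<N. \<forall>i<k. \<forall>j<k.
             M $$ (a * k + i, b * k + j) = B ((a + N - b) mod N) $$ (i, j)))"

definition F_circulant :: "nat \<Rightarrow> nat \<Rightarrow> tensor \<Rightarrow> bool" where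
  "F_circulant n p A \<longleftrightarrow> A \<in> tensor_carrier n n p \<and> (\<forall>M \<in> set A. circulant_mat n M)"

text \<open>All frontal slices are partitioned in the same way.\<close>

definition F_block_circulant_F_circulant_blocks ::
  "nat \<Rightarrow> nat \<Rightarrow> nat \<Rightarrow> nat \<Rightarrow> nat \<Rightarrow> tensor \<Rightarrow> bool" where
  "F_block_circulant_F_circulant_blocks N k m n p A \<longleftrightarrow>
     A \<in> tensor_carrier m n p \<and> (\<forall>M \<in> set A. block_circulant_circulant_blocks N k M)"

end

theory Submission
  imports Defs
begin

text \<open>
  The map \<open>bcirc\<close> is an injective *-homomorphism into matrices, so tensors may be computed with as
  if they were matrices. If \<open>P\<close>, \<open>Q\<close> are unitary and \<open>U\<close>, \<open>S\<close>, \<open>V\<close> is a T-SVD of \<open>A\<close>, then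
  \<open>P * U\<close>, \<open>S\<close>, \<open>Q * V\<close> is a T-SVD of \<open>P * A * Q\<^sup>H\<close> with the same singular values; as the value at
  \<open>A\<close> does not depend on the T-SVD, every symmetry \<open>P * A * Q\<^sup>H = A\<close> is inherited by the generalized
  function. Circulant structures are such symmetries, with permutation tensors \<open>P = Q\<close>.
  Conjugating a T-SVD entrywise gives a T-SVD in which the singular value blocks are permuted by
  \<open>k \<mapsto> -k mod p\<close>, because conjugation turns the Fourier matrix into its inverse; combined with the
  unitary exchange tensors this gives the (skew-)centrohermitian case.
\<close>

subsection \<open>Matrices\<close>

text \<open>The symmetry argument covers circulant and centrohermitian structure, but normality
  takes another route. It is shown for each single value obtained from a T-SVD: the Fourier factor
  is merged with \<open>bcirc U\<close> and \<open>bcirc V\<close>, so that \<open>bcirc A\<close>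
  becomes unitary times diagonal times unitary, and normality ties the two unitary factors together
  at equal singular values. Two obstacles shape the rest. The inverse of \<open>bcirc\<close> is a
  choice function, so the Fourier block diagonal matrix built from \<open>f_tilde\<close> must be
  shown to be block circulant before anything can be computed with \<open>f_hat\<close>. And
  conjugation does not commute with an arbitrary \<open>f\<close>: the conjugated middle factor is
  again of the form \<open>f_hat\<close> because reality of \<open>f\<close> on the positive
  singular values makes the blocks given by \<open>f_tilde\<close> real.\<close>

lemma sum_div_mod:
  fixes g :: "nat \<Rightarrow> nat \<Rightarrow> 'a::comm_monoid_add"
  shows "(\<Sum>r<n * p. g (r div n) (r mod n)) = (\<Sum>l<p. \<Sum>q<n. g l q)"
proof -
  have "(\<Sum>r<n * p. g (r div n) (r mod n)) = (\<Sum>l<p. \<Sum>r = l * n..<l * n + n. g (r div n) (r mod n))"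
    by (subst sum.nat_group) (simp add: mult.commute)
  also have "\<dots> = (\<Sum>l<p. \<Sum>q<n. g l q)"
  proof (rule sum.cong[OF refl])
    fix l
    have "(\<Sum>r = l * n..<l * n + n. g (r div n) (r mod n))
        = (\<Sum>q = 0..<n. g ((q + l * n) div n) ((q + l * n) mod n))"
      using sum.shift_bounds_nat_ivl[of "\<lambda>r. g (r div n) (r mod n)" 0 "l * n" n]
      by (simp add: add.commute)
    also have "\<dots> = (\<Sum>q<n. g l q)"
      by (auto simp: atLeast0LessThan intro!: sum.cong)
    finally show "(\<Sum>r = l * n..<l * n + n. g (r div n) (r mod n)) = (\<Sum>q<n. g l q)" .
  qed
  finally show ?thesis .
qed

lemma index_mult_sum:
  assumes "A \<in> carrier_mat m n" "B \<in> carrier_mat n s" "i < m" "j < s"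
  shows "(A * B) $$ (i, j) = (\<Sum>r<n. A $$ (i, r) * B $$ (r, j))"
  using assms by (auto simp: scalar_prod_def atLeast0LessThan intro!: sum.cong)

lemma div_less_of_less_mult:
  fixes i m p :: nat
  assumes "i < m * p"
  shows "i div m < p" "i mod m < m"
proof -
  from assms have "0 < m" by (cases m) auto
  with assms show "i div m < p" "i mod m < m"
    by (auto simp: less_mult_imp_div_less mult.commute)
qed

lemma block_index_less:
  fixes i k m p :: nat
  assumes "k < p" "i < m"
  shows "k * m + i < m * p"
proof -
  have "k * m + i < Suc k * m" using assms by simp
  also have "\<dots> \<le> p * m" using assms by (intro mult_le_mono1) simp
  finally show ?thesis by (simp add: mult.commute)
qed

lemma mat_adjoint_dim [simp]:
  "dim_row (mat_adjoint A) = dim_col A" "dim_col (mat_adjoint A) = dim_row A"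
  unfolding mat_adjoint_def by auto

lemma mat_adjoint_carrier [simp]: "A \<in> carrier_mat m n \<Longrightarrow> mat_adjoint A \<in> carrier_mat n m"
  by (auto intro!: carrier_matI)

lemma mat_adjoint_index [simp]:
  fixes A :: "complex mat"
  assumes "i < dim_col A" "j < dim_row A"
  shows "mat_adjoint A $$ (i, j) = cnj (A $$ (j, i))"
  using assms unfolding mat_adjoint_def by (simp add: mat_of_rows_def)

lemma mat_adjoint_adjoint [simp]: "mat_adjoint (mat_adjoint A) = (A :: complex mat)"
  by (rule eq_matI) auto

lemma mat_adjoint_one [simp]: "mat_adjoint (1\<^sub>m n :: complex mat) = 1\<^sub>m n"
  by (rule eq_matI) auto

lemma mat_adjoint_mult:
  fixes A B :: "complex mat"
  assumes "A \<in> carrier_mat m n" "B \<in> carrier_mat n s"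
  shows "mat_adjoint (A * B) = mat_adjoint B * mat_adjoint A"
proof (rule eq_matI)
  fix i j assume "i < dim_row (mat_adjoint B * mat_adjoint A)"
    "j < dim_col (mat_adjoint B * mat_adjoint A)"
  then have "i < s" "j < m" using assms by auto
  then show "mat_adjoint (A * B) $$ (i, j) = (mat_adjoint B * mat_adjoint A) $$ (i, j)"
    using assms index_mult_sum[OF assms, of j i]
      index_mult_sum[of "mat_adjoint B" s n "mat_adjoint A" m i j]
    by (auto simp del: index_mult_mat(1) intro!: sum.cong)
qed (use assms in auto)

text \<open>Equal block sizes turn the recursive construction into a closed formula in quotient and
  remainder, the same coordinates in which \<open>bcirc\<close> and \<open>kron\<close> are
  indexed.\<close>

lemma index_diag_block_mat:
  assumes "set Ds \<subseteq> carrier_mat m n" "i < m * length Ds" "j < n * length Ds"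
  shows "diag_block_mat Ds $$ (i, j) =
    (if i div m = j div n then Ds ! (i div m) $$ (i mod m, j mod n) else 0)"
  using assms
proof (induction Ds arbitrary: i j)
  case (Cons D Ds)
  have D: "dim_row D = m" "dim_col D = n" using Cons.prems by auto
  have rows: "map dim_row Ds = replicate (length Ds) m" "map dim_col Ds = replicate (length Ds) n"
    using Cons.prems by (auto simp: map_replicate_const[symmetric])
  have dims: "dim_row (diag_block_mat Ds) = m * length Ds" "dim_col (diag_block_mat Ds) = n * length Ds"
    by (simp_all add: dim_diag_block_mat rows sum_list_replicate mult.commute)
  have pos: "0 < m" "0 < n" using Cons.prems by (auto intro: gr0I)
  have IH: "diag_block_mat Ds $$ (i - m, j - n) =
      (if (i - m) div m = (j - n) div n then Ds ! ((i - m) div m) $$ ((i - m) mod m, (j - n) mod n) else 0)"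
    if "m \<le> i" "n \<le> j"
    using Cons.IH[of "i - m" "j - n"] Cons.prems that by auto
  have i: "i div m = (if i < m then 0 else Suc ((i - m) div m))"
      "i mod m = (if i < m then i else (i - m) mod m)"
    using pos by (auto simp: div_if mod_if)
  have j: "j div n = (if j < n then 0 else Suc ((j - n) div n))"
      "j mod n = (if j < n then j else (j - n) mod n)"
    using pos by (auto simp: div_if mod_if)
  show ?case
    using Cons.prems IH pos unfolding i j
    by (auto simp: Let_def D dims)
qed auto

lemma diag_block_mat_carrier:
  assumes "set Ds \<subseteq> carrier_mat m n"
  shows "diag_block_mat Ds \<in> carrier_mat (m * length Ds) (n * length Ds)"
proof -
  have "map dim_row Ds = replicate (length Ds) m" "map dim_col Ds = replicate (length Ds) n"
    using assms by (auto simp: map_replicate_const[symmetric])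
  then show ?thesis
    by (intro carrier_matI) (simp_all add: dim_diag_block_mat sum_list_replicate mult.commute)
qed

subsection \<open>The T-product algebra\<close>

lemma tensor_carrierI:
  assumes "length A = p" "\<And>k. k < p \<Longrightarrow> A ! k \<in> carrier_mat m n"
  shows "A \<in> tensor_carrier m n p"
  using assms unfolding tensor_carrier_def by (auto simp: set_conv_nth)

lemma tensor_carrierD:
  assumes "A \<in> tensor_carrier m n p"
  shows "length A = p" "k < p \<Longrightarrow> A ! k \<in> carrier_mat m n"
  using assms unfolding tensor_carrier_def by auto

lemma tensor_dims:
  assumes "A \<in> tensor_carrier m n p" "k < p"
  shows "dim_row (A ! k) = m" "dim_col (A ! k) = n"
  using tensor_carrierD(2)[OF assms] by auto

lemma tensor_eqI:
  assumes "A \<in> tensor_carrier m n p" "B \<in> tensor_carrier m n p"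
    and "\<And>k i j. k < p \<Longrightarrow> i < m \<Longrightarrow> j < n \<Longrightarrow> A ! k $$ (i, j) = B ! k $$ (i, j)"
  shows "A = B"
proof (rule nth_equalityI)
  show "length A = length B" using assms by (simp add: tensor_carrierD)
next
  fix k assume "k < length A"
  then have k: "k < p" using assms by (simp add: tensor_carrierD)
  show "A ! k = B ! k"
    by (rule eq_matI) (use assms k tensor_dims in auto)
qed

lemma bcirc_carrier [simp]:
  assumes "0 < p" "A \<in> tensor_carrier m n p"
  shows "bcirc A \<in> carrier_mat (m * p) (n * p)"
  using tensor_dims[OF assms(2,1)] tensor_carrierD[OF assms(2)]
  by (auto simp: bcirc_def Let_def intro!: carrier_matI)

lemma bcirc_index:
  assumes "0 < p" "A \<in> tensor_carrier m n p" "i < m * p" "j < n * p"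
  shows "bcirc A $$ (i, j) = A ! ((i div m + p - j div n) mod p) $$ (i mod m, j mod n)"
  using tensor_dims[OF assms(2,1)] tensor_carrierD[OF assms(2)] assms
  by (auto simp: bcirc_def Let_def)

text \<open>The first block column of \<open>bcirc A\<close> is the stack of the frontal slices, so
  the tensor can be read off. Algebraic laws of matrices are transferred to tensors through this
  lemma.\<close>

lemma bcirc_inj:
  assumes "0 < p" "A \<in> tensor_carrier m n p" "B \<in> tensor_carrier m n p" "bcirc A = bcirc B"
  shows "A = B"
proof (rule tensor_eqI[OF assms(2,3)])
  fix k i j assume k: "k < p" "i < m" "j < n"
  have j: "j < n * p" using block_index_less[OF assms(1) k(3)] by simp
  have "bcirc C $$ (k * m + i, j) = C ! k $$ (i, j)" if "C \<in> tensor_carrier m n p" for C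
    using bcirc_index[OF assms(1) that block_index_less[OF k(1,2)] j] k by simp
  from this[OF assms(2)] this[OF assms(3)] show "A ! k $$ (i, j) = B ! k $$ (i, j)"
    using assms(4) by simp
qed

lemma t_prod_carrier [simp]:
  assumes "0 < p" "A \<in> tensor_carrier m n p" "B \<in> tensor_carrier n s p"
  shows "A *\<^sub>T B \<in> tensor_carrier m s p"
  using tensor_dims[OF assms(2,1)] tensor_dims[OF assms(3,1)] tensor_carrierD[OF assms(2)] assms(1)
    bcirc_carrier[OF assms(1,2)]
  by (intro tensor_carrierI) (auto simp: t_prod_def t_fold_def t_unfold_def Let_def)

text \<open>The T-product is the circular convolution of the two sequences of slices.\<close>

lemma t_prod_index:
  assumes "0 < p" "A \<in> tensor_carrier m n p" "B \<in> tensor_carrier n s p" "k < p" "i < m" "j < s"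
  shows "(A *\<^sub>T B) ! k $$ (i, j) =
    (\<Sum>l<p. \<Sum>q<n. A ! ((k + p - l) mod p) $$ (i, q) * B ! l $$ (q, j))"
proof -
  have u: "t_unfold B \<in> carrier_mat (n * p) s"
    using tensor_dims[OF assms(3,1)] tensor_carrierD(1)[OF assms(3)]
    by (auto simp: t_unfold_def Let_def)
  note c = bcirc_carrier[OF assms(1,2)]
  have "(A *\<^sub>T B) ! k $$ (i, j) = (bcirc A * t_unfold B) $$ (k * m + i, j)"
    using assms carrier_matD[OF c] u tensor_carrierD(1)[OF assms(2)]
    by (simp add: t_prod_def t_fold_def Let_def del: index_mult_mat(1))
  also have "\<dots> = (\<Sum>r<n * p. bcirc A $$ (k * m + i, r) * t_unfold B $$ (r, j))"
    using index_mult_sum[OF c u block_index_less[OF assms(4,5)] assms(6)] .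
  also have "\<dots> = (\<Sum>r<n * p. A ! ((k + p - r div n) mod p) $$ (i, r mod n) * B ! (r div n) $$ (r mod n, j))"
    using bcirc_index[OF assms(1,2) block_index_less[OF assms(4,5)]] assms
      tensor_dims[OF assms(3,1)] tensor_carrierD(1)[OF assms(3)]
    by (auto simp: t_unfold_def Let_def intro!: sum.cong)
  also have "\<dots> = (\<Sum>l<p. \<Sum>q<n. A ! ((k + p - l) mod p) $$ (i, q) * B ! l $$ (q, j))"
    by (rule sum_div_mod)
  finally show ?thesis .
qed

text \<open>Differences modulo \<open>p\<close> appear as \<open>(a + p - b) mod p\<close> with
  \<open>a\<close> and \<open>b\<close> below \<open>p\<close>, hence as residues of numbers below
  \<open>2 * p\<close>. The case split hands them over to linear arithmetic.\<close>

lemma mod_less_twice: "x < 2 * p \<Longrightarrow> x mod p = (if x < p then x else x - p)" for x p :: nat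
  by (simp add: le_mod_geq)

lemma sum_mod_shift:
  fixes h :: "nat \<Rightarrow> 'a::comm_monoid_add"
  assumes "b < p"
  shows "(\<Sum>l<p. h ((l + p - b) mod p)) = (\<Sum>l<p. h l)"
proof (rule sum.reindex_bij_witness[where i = "\<lambda>l. (l + b) mod p" and j = "\<lambda>l. (l + p - b) mod p"])
  fix a assume "a \<in> {..<p}"
  then show "((a + p - b) mod p + b) mod p = a" "(a + p - b) mod p \<in> {..<p}"
    "((a + b) mod p + p - b) mod p = a" "(a + b) mod p \<in> {..<p}"
    using assms by (auto simp: mod_less_twice)
qed auto

lemma bcirc_mult:
  assumes "0 < p" "A \<in> tensor_carrier m n p" "B \<in> tensor_carrier n s p"
  shows "bcirc (A *\<^sub>T B) = bcirc A * bcirc B"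
proof (rule eq_matI)
  note cA = bcirc_carrier[OF assms(1,2)] and cB = bcirc_carrier[OF assms(1,3)]
    and cAB = bcirc_carrier[OF assms(1) t_prod_carrier[OF assms]]
  show "dim_row (bcirc (A *\<^sub>T B)) = dim_row (bcirc A * bcirc B)"
    "dim_col (bcirc (A *\<^sub>T B)) = dim_col (bcirc A * bcirc B)"
    using cA cB cAB by auto
  fix i j assume "i < dim_row (bcirc A * bcirc B)" "j < dim_col (bcirc A * bcirc B)"
  then have ij: "i < m * p" "j < s * p" using cA cB by auto
  define a b where "a = i div m" and "b = j div s"
  have a: "a < p" "i mod m < m" and b: "b < p" "j mod s < s"
    unfolding a_def b_def using div_less_of_less_mult ij by auto
  define k where "k = (a + p - b) mod p"
  have k: "k < p" unfolding k_def using assms(1) by simp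
  have "bcirc (A *\<^sub>T B) $$ (i, j) = (A *\<^sub>T B) ! k $$ (i mod m, j mod s)"
    using bcirc_index[OF assms(1) t_prod_carrier[OF assms] ij] by (simp add: k_def a_def b_def)
  also have "\<dots> = (\<Sum>l<p. \<Sum>q<n. A ! ((k + p - l) mod p) $$ (i mod m, q) * B ! l $$ (q, j mod s))"
    using t_prod_index[OF assms k a(2) b(2)] .
  \<comment> \<open>Replacing \<open>l\<close> by \<open>l - b\<close> modulo \<open>p\<close> turns
    the slice indices \<open>a - b - l\<close> and \<open>l\<close> of the convolution into
    \<open>a - l\<close> and \<open>l - b\<close>, which are the block positions of a matrix
    product.\<close>
  also have "\<dots> = (\<Sum>l<p. \<Sum>q<n. A ! ((k + p - ((l + p - b) mod p)) mod p) $$ (i mod m, q)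
      * B ! ((l + p - b) mod p) $$ (q, j mod s))"
    by (rule sum_mod_shift[OF b(1), symmetric])
  also have "\<dots> = (\<Sum>l<p. \<Sum>q<n. A ! ((a + p - l) mod p) $$ (i mod m, q)
      * B ! ((l + p - b) mod p) $$ (q, j mod s))"
  proof (rule sum.cong[OF refl])
    fix l assume "l \<in> {..<p}"
    then have "(k + p - ((l + p - b) mod p)) mod p = (a + p - l) mod p"
      using a b unfolding k_def by (auto simp: mod_less_twice)
    then show "(\<Sum>q<n. A ! ((k + p - ((l + p - b) mod p)) mod p) $$ (i mod m, q)
        * B ! ((l + p - b) mod p) $$ (q, j mod s)) = (\<Sum>q<n. A ! ((a + p - l) mod p) $$ (i mod m, q)
        * B ! ((l + p - b) mod p) $$ (q, j mod s))" by simp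
  qed
  also have "\<dots> = (\<Sum>r<n * p. A ! ((a + p - r div n) mod p) $$ (i mod m, r mod n)
      * B ! ((r div n + p - b) mod p) $$ (r mod n, j mod s))"
    by (rule sum_div_mod[symmetric])
  also have "\<dots> = (\<Sum>r<n * p. bcirc A $$ (i, r) * bcirc B $$ (r, j))"
    using bcirc_index[OF assms(1,2) ij(1)] bcirc_index[OF assms(1,3) _ ij(2)]
    by (simp add: a_def b_def)
  also have "\<dots> = (bcirc A * bcirc B) $$ (i, j)"
    by (rule index_mult_sum[OF cA cB ij, symmetric])
  finally show "bcirc (A *\<^sub>T B) $$ (i, j) = (bcirc A * bcirc B) $$ (i, j)" .
qed

lemma t_prod_assoc:
  assumes p: "0 < p" and "A \<in> tensor_carrier m n p" "B \<in> tensor_carrier n s p" "C \<in> tensor_carrier s t p"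
  shows "(A *\<^sub>T B) *\<^sub>T C = A *\<^sub>T (B *\<^sub>T C)"
proof (rule bcirc_inj[OF p])
  show "(A *\<^sub>T B) *\<^sub>T C \<in> tensor_carrier m t p" "A *\<^sub>T (B *\<^sub>T C) \<in> tensor_carrier m t p"
    using t_prod_carrier[OF p t_prod_carrier[OF p assms(2,3)] assms(4)]
      t_prod_carrier[OF p assms(2) t_prod_carrier[OF p assms(3,4)]] by simp_all
  show "bcirc ((A *\<^sub>T B) *\<^sub>T C) = bcirc (A *\<^sub>T (B *\<^sub>T C))"
    using bcirc_mult[OF p assms(2,3)] bcirc_mult[OF p assms(3,4)]
      bcirc_mult[OF p t_prod_carrier[OF p assms(2,3)] assms(4)]
      bcirc_mult[OF p assms(2) t_prod_carrier[OF p assms(3,4)]]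
      bcirc_carrier[OF p assms(2)] bcirc_carrier[OF p assms(3)] bcirc_carrier[OF p assms(4)]
    by (simp add: assoc_mult_mat)
qed

section \<open>Adjoint tensors\<close>

lemma t_adjoint_carrier [simp]:
  assumes "A \<in> tensor_carrier m n p"
  shows "t_adjoint A \<in> tensor_carrier n m p"
  using tensor_carrierD[OF assms]
  by (intro tensor_carrierI) (auto simp: t_adjoint_def Let_def)

lemma bcirc_adjoint:
  assumes p: "0 < p" and A: "A \<in> tensor_carrier m n p"
  shows "bcirc (t_adjoint A) = mat_adjoint (bcirc A)"
proof (rule eq_matI)
  note c = bcirc_carrier[OF assms] and c' = bcirc_carrier[OF p t_adjoint_carrier[OF A]]
  show "dim_row (bcirc (t_adjoint A)) = dim_row (mat_adjoint (bcirc A))"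
    "dim_col (bcirc (t_adjoint A)) = dim_col (mat_adjoint (bcirc A))"
    using c c' by auto
  fix i j assume "i < dim_row (mat_adjoint (bcirc A))" "j < dim_col (mat_adjoint (bcirc A))"
  then have ij: "i < n * p" "j < m * p" using c by auto
  note d = div_less_of_less_mult[OF ij(1)] div_less_of_less_mult[OF ij(2)]
  \<comment> \<open>The reversal of slices in the adjoint matches the exchange of block row and
    block column: \<open>-(a - b) = b - a\<close> modulo \<open>p\<close>.\<close>
  have "(p - (i div n + p - j div m) mod p) mod p = (j div m + p - i div n) mod p"
    using d by (auto simp: mod_less_twice)
  then show "bcirc (t_adjoint A) $$ (i, j) = mat_adjoint (bcirc A) $$ (i, j)"
    using bcirc_index[OF p t_adjoint_carrier[OF A] ij] bcirc_index[OF p A ij(2,1)] c ij p d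
      tensor_carrierD(1)[OF A] tensor_dims[OF A]
    by (simp add: t_adjoint_def Let_def)
qed

lemma t_adjoint_prod:
  assumes p: "0 < p" and A: "A \<in> tensor_carrier m n p" and B: "B \<in> tensor_carrier n s p"
  shows "t_adjoint (A *\<^sub>T B) = t_adjoint B *\<^sub>T t_adjoint A"
proof (rule bcirc_inj[OF p])
  show "t_adjoint (A *\<^sub>T B) \<in> tensor_carrier s m p" "t_adjoint B *\<^sub>T t_adjoint A \<in> tensor_carrier s m p"
    using t_prod_carrier[OF p A B] t_prod_carrier[OF p t_adjoint_carrier[OF B] t_adjoint_carrier[OF A]]
    by simp_all
  show "bcirc (t_adjoint (A *\<^sub>T B)) = bcirc (t_adjoint B *\<^sub>T t_adjoint A)"
    using bcirc_adjoint[OF p t_prod_carrier[OF p A B]] bcirc_adjoint[OF p A] bcirc_adjoint[OF p B]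
      bcirc_mult[OF p A B] bcirc_mult[OF p t_adjoint_carrier[OF B] t_adjoint_carrier[OF A]]
      mat_adjoint_mult[OF bcirc_carrier[OF p A] bcirc_carrier[OF p B]]
    by simp
qed

lemma t_adjoint_adjoint:
  assumes p: "0 < p" and A: "A \<in> tensor_carrier m n p"
  shows "t_adjoint (t_adjoint A) = A"
  using bcirc_adjoint[OF p t_adjoint_carrier[OF A]] bcirc_adjoint[OF p A] A
  by (intro bcirc_inj[OF p _ A]) simp_all

lemma t_id_carrier [simp]: "0 < p \<Longrightarrow> t_id n p \<in> tensor_carrier n n p"
  unfolding t_id_def tensor_carrier_def by auto

text \<open>The first slice is the unit position of the circular convolution, so this is an
  embedding of matrices that respects products and adjoints. Identity, exchange and permutation
  tensors all lie in its image.\<close>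

definition t_const :: "nat \<Rightarrow> complex mat \<Rightarrow> tensor" where
  "t_const p M = M # replicate (p - 1) (0\<^sub>m (dim_row M) (dim_col M))"

lemma t_const_carrier [simp]: "0 < p \<Longrightarrow> M \<in> carrier_mat m n \<Longrightarrow> t_const p M \<in> tensor_carrier m n p"
  unfolding t_const_def tensor_carrier_def by auto

lemma t_const_nth: "k < p \<Longrightarrow> t_const p M ! k = (if k = 0 then M else 0\<^sub>m (dim_row M) (dim_col M))"
  unfolding t_const_def by (cases k) auto

lemma t_id_eq_const: "t_id n p = t_const p (1\<^sub>m n)"
  unfolding t_id_def t_const_def by simp

lemma t_const_mult:
  assumes p: "0 < p" and M: "M \<in> carrier_mat m n" and A: "A \<in> tensor_carrier n s p"
  shows "t_const p M *\<^sub>T A = map (\<lambda>X. M * X) A"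
proof (rule tensor_eqI[OF t_prod_carrier[OF p t_const_carrier[OF p M] A]])
  show "map (\<lambda>X. M * X) A \<in> tensor_carrier m s p"
    using M A unfolding tensor_carrier_def by auto
  fix k i j assume k: "k < p" "i < m" "j < s"
  have "(t_const p M *\<^sub>T A) ! k $$ (i, j)
      = (\<Sum>l<p. \<Sum>q<n. t_const p M ! ((k + p - l) mod p) $$ (i, q) * A ! l $$ (q, j))"
    by (rule t_prod_index[OF p t_const_carrier[OF p M] A k])
  \<comment> \<open>The index \<open>(k + p - l) mod p\<close> is 0 exactly for
    \<open>l = k\<close>, so one term of the convolution survives.\<close>
  also have "\<dots> = (\<Sum>l<p. if l = k then \<Sum>q<n. M $$ (i, q) * A ! k $$ (q, j) else 0)"
    using k M by (intro sum.cong) (auto simp: t_const_nth mod_less_twice)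
  also have "\<dots> = (\<Sum>q<n. M $$ (i, q) * A ! k $$ (q, j))" using k by simp
  also have "\<dots> = map (\<lambda>X. M * X) A ! k $$ (i, j)"
    using index_mult_sum[OF M tensor_carrierD(2)[OF A k(1)] k(2,3)] tensor_carrierD(1)[OF A] k by simp
  finally show "(t_const p M *\<^sub>T A) ! k $$ (i, j) = map (\<lambda>X. M * X) A ! k $$ (i, j)" .
qed

lemma mult_t_const:
  assumes p: "0 < p" and A: "A \<in> tensor_carrier m n p" and M: "M \<in> carrier_mat n s"
  shows "A *\<^sub>T t_const p M = map (\<lambda>X. X * M) A"
proof (rule tensor_eqI[OF t_prod_carrier[OF p A t_const_carrier[OF p M]]])
  show "map (\<lambda>X. X * M) A \<in> tensor_carrier m s p"
    using M A unfolding tensor_carrier_def by auto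
  fix k i j assume k: "k < p" "i < m" "j < s"
  have "(A *\<^sub>T t_const p M) ! k $$ (i, j)
      = (\<Sum>l<p. \<Sum>q<n. A ! ((k + p - l) mod p) $$ (i, q) * t_const p M ! l $$ (q, j))"
    by (rule t_prod_index[OF p A t_const_carrier[OF p M] k])
  also have "\<dots> = (\<Sum>l<p. if l = 0 then \<Sum>q<n. A ! k $$ (i, q) * M $$ (q, j) else 0)"
    using k M by (intro sum.cong) (auto simp: t_const_nth)
  also have "\<dots> = (\<Sum>q<n. A ! k $$ (i, q) * M $$ (q, j))" using p by simp
  also have "\<dots> = map (\<lambda>X. X * M) A ! k $$ (i, j)"
    using index_mult_sum[OF tensor_carrierD(2)[OF A k(1)] M k(2,3)] tensor_carrierD(1)[OF A] k by simp
  finally show "(A *\<^sub>T t_const p M) ! k $$ (i, j) = map (\<lambda>X. X * M) A ! k $$ (i, j)" .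
qed

lemma t_id_mult [simp]:
  assumes "0 < p" "A \<in> tensor_carrier m n p"
  shows "t_id m p *\<^sub>T A = A" "A *\<^sub>T t_id n p = A"
proof -
  have "map (\<lambda>X. 1\<^sub>m m * X) A = A" "map (\<lambda>X. X * 1\<^sub>m n) A = A"
    using assms(2) unfolding tensor_carrier_def by (auto intro!: map_idI)
  then show "t_id m p *\<^sub>T A = A" "A *\<^sub>T t_id n p = A"
    using t_const_mult[OF assms(1) one_carrier_mat assms(2)]
      mult_t_const[OF assms one_carrier_mat] by (simp_all add: t_id_eq_const)
qed

lemma t_adjoint_const:
  assumes "0 < p"
  shows "t_adjoint (t_const p M) = t_const p (mat_adjoint M)"
proof (rule tensor_eqI)
  have M: "M \<in> carrier_mat (dim_row M) (dim_col M)" by auto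
  show "t_adjoint (t_const p M) \<in> tensor_carrier (dim_col M) (dim_row M) p"
    "t_const p (mat_adjoint M) \<in> tensor_carrier (dim_col M) (dim_row M) p"
    using assms by auto
  fix k i j assume "k < p" "i < dim_col M" "j < dim_row M"
  then show "t_adjoint (t_const p M) ! k $$ (i, j) = t_const p (mat_adjoint M) ! k $$ (i, j)"
    using tensor_carrierD(1)[OF t_const_carrier[OF assms M]]
    by (cases "k = 0") (auto simp: t_adjoint_def Let_def t_const_nth)
qed

lemma t_const_mult_const:
  assumes "0 < p" "M \<in> carrier_mat m n" "L \<in> carrier_mat n s"
  shows "t_const p M *\<^sub>T t_const p L = t_const p (M * L)"
  using t_const_mult[OF assms(1,2) t_const_carrier[OF assms(1,3)]] assms
  by (simp add: t_const_def map_replicate)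

text \<open>One of the two identities is enough, since a one-sided inverse of a square matrix is
  two-sided.\<close>

lemma t_unitary_const:
  assumes "0 < p" "M \<in> carrier_mat n n" "mat_adjoint M * M = 1\<^sub>m n"
  shows "t_unitary n p (t_const p M)"
  using assms mat_mult_left_right_inverse[OF mat_adjoint_carrier[OF assms(2)] assms(2,3)]
    t_const_mult_const[OF assms(1) mat_adjoint_carrier[OF assms(2)] assms(2)]
    t_const_mult_const[OF assms(1,2) mat_adjoint_carrier[OF assms(2)]]
  by (simp add: t_unitary_def t_adjoint_const t_id_eq_const)

section \<open>Unitary tensors\<close>

lemma t_unitaryD:
  assumes "t_unitary n p Q"
  shows "Q \<in> tensor_carrier n n p" "t_adjoint Q *\<^sub>T Q = t_id n p" "Q *\<^sub>T t_adjoint Q = t_id n p"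
  using assms unfolding t_unitary_def by auto

lemma t_unitary_mult:
  assumes p: "0 < p" and P: "t_unitary n p P" and Q: "t_unitary n p Q"
  shows "t_unitary n p (P *\<^sub>T Q)"
proof -
  note c = t_unitaryD(1)[OF P] t_unitaryD(1)[OF Q]
  note a = t_adjoint_carrier[OF c(1)] t_adjoint_carrier[OF c(2)]
  have "t_adjoint Q *\<^sub>T t_adjoint P *\<^sub>T (P *\<^sub>T Q)
      = t_adjoint Q *\<^sub>T ((t_adjoint P *\<^sub>T P) *\<^sub>T Q)"
    using t_prod_assoc[OF p a(2,1) t_prod_carrier[OF p c]] t_prod_assoc[OF p a(1) c] by simp
  moreover have "P *\<^sub>T Q *\<^sub>T (t_adjoint Q *\<^sub>T t_adjoint P)
      = P *\<^sub>T ((Q *\<^sub>T t_adjoint Q) *\<^sub>T t_adjoint P)"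
    using t_prod_assoc[OF p c t_prod_carrier[OF p a(2,1)]] t_prod_assoc[OF p c(2) a(2,1)] by simp
  ultimately show ?thesis
    using t_unitaryD[OF P] t_unitaryD[OF Q] p c a
    by (simp add: t_unitary_def t_adjoint_prod[OF p c])
qed

section \<open>Entrywise conjugation\<close>

lemma t_cnj_carrier [simp]: "A \<in> tensor_carrier m n p \<Longrightarrow> t_cnj A \<in> tensor_carrier m n p"
  unfolding tensor_carrier_def t_cnj_def by auto

lemma t_cnj_index [simp]:
  assumes "A \<in> tensor_carrier m n p" "k < p" "i < m" "j < n"
  shows "t_cnj A ! k $$ (i, j) = cnj (A ! k $$ (i, j))"
  using assms tensor_carrierD(1)[OF assms(1)] tensor_dims[OF assms(1,2)] by (simp add: t_cnj_def)

lemma t_cnj_prod: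
  assumes p: "0 < p" and A: "A \<in> tensor_carrier m n p" and B: "B \<in> tensor_carrier n s p"
  shows "t_cnj (A *\<^sub>T B) = t_cnj A *\<^sub>T t_cnj B"
proof (rule tensor_eqI)
  show "t_cnj (A *\<^sub>T B) \<in> tensor_carrier m s p" "t_cnj A *\<^sub>T t_cnj B \<in> tensor_carrier m s p"
    using t_prod_carrier[OF p A B] t_prod_carrier[OF p t_cnj_carrier[OF A] t_cnj_carrier[OF B]] by simp_all
  fix k i j assume k: "k < p" "i < m" "j < s"
  show "t_cnj (A *\<^sub>T B) ! k $$ (i, j) = (t_cnj A *\<^sub>T t_cnj B) ! k $$ (i, j)"
    using t_cnj_index[OF t_prod_carrier[OF p A B] k] t_prod_index[OF p A B k]
      t_prod_index[OF p t_cnj_carrier[OF A] t_cnj_carrier[OF B] k] t_cnj_index[OF A] t_cnj_index[OF B] k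
    by simp
qed

lemma t_cnj_adjoint:
  assumes A: "A \<in> tensor_carrier m n p"
  shows "t_cnj (t_adjoint A) = t_adjoint (t_cnj A)"
proof (rule tensor_eqI)
  show "t_cnj (t_adjoint A) \<in> tensor_carrier n m p" "t_adjoint (t_cnj A) \<in> tensor_carrier n m p"
    using A by simp_all
  fix k i j assume k: "k < p" "i < n" "j < m"
  then have "(p - k) mod p < p" by simp
  then show "t_cnj (t_adjoint A) ! k $$ (i, j) = t_adjoint (t_cnj A) ! k $$ (i, j)"
    using t_cnj_index[OF t_adjoint_carrier[OF A] k] k tensor_carrierD(1)[OF A]
      tensor_carrierD(1)[OF t_cnj_carrier[OF A]] tensor_dims[OF A] tensor_dims[OF t_cnj_carrier[OF A]]
      t_cnj_index[OF A, of "(p - k) mod p" j i]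
    by (simp add: t_adjoint_def Let_def)
qed

lemma t_cnj_id: "t_cnj (t_id n p) = t_id n p"
  by (auto simp: t_cnj_def t_id_def map_replicate intro!: eq_matI)

lemma t_unitary_cnj:
  assumes p: "0 < p" and Q: "t_unitary n p Q"
  shows "t_unitary n p (t_cnj Q)"
proof -
  note Q' = t_unitaryD[OF Q] and a = t_adjoint_carrier[OF t_unitaryD(1)[OF Q]]
  have "t_adjoint (t_cnj Q) *\<^sub>T t_cnj Q = t_cnj (t_adjoint Q *\<^sub>T Q)"
    "t_cnj Q *\<^sub>T t_adjoint (t_cnj Q) = t_cnj (Q *\<^sub>T t_adjoint Q)"
    by (simp_all only: t_cnj_prod[OF p a Q'(1)] t_cnj_prod[OF p Q'(1) a] t_cnj_adjoint[OF Q'(1)])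
  then show ?thesis using Q' by (simp add: t_unitary_def t_cnj_id)
qed

lemma bcirc_cnj:
  assumes p: "0 < p" and A: "A \<in> tensor_carrier m n p"
  shows "bcirc (t_cnj A) = map_mat cnj (bcirc A)"
proof (rule eq_matI)
  note c = bcirc_carrier[OF p A] bcirc_carrier[OF p t_cnj_carrier[OF A]]
  show "dim_row (bcirc (t_cnj A)) = dim_row (map_mat cnj (bcirc A))"
    "dim_col (bcirc (t_cnj A)) = dim_col (map_mat cnj (bcirc A))" using c by auto
  fix i j assume "i < dim_row (map_mat cnj (bcirc A))" "j < dim_col (map_mat cnj (bcirc A))"
  then have ij: "i < m * p" "j < n * p" using c by auto
  show "bcirc (t_cnj A) $$ (i, j) = map_mat cnj (bcirc A) $$ (i, j)"
    using ij bcirc_index[OF p A ij] bcirc_index[OF p t_cnj_carrier[OF A] ij] c p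
      t_cnj_index[OF A _ div_less_of_less_mult(2)[OF ij(1)] div_less_of_less_mult(2)[OF ij(2)]]
    by simp
qed

subsection \<open>Fourier block diagonalization\<close>

definition dft_root :: "nat \<Rightarrow> complex" where
  "dft_root p = exp (- (2 * of_real pi * \<i> / of_nat p))"

lemma dft_root_eq_cis: "dft_root p = cis (- (2 * pi / real p))"
  unfolding dft_root_def cis_conv_exp by (rule arg_cong[of _ _ exp]) simp

lemma dft_root_power_p: "0 < p \<Longrightarrow> dft_root p ^ p = 1"
  unfolding dft_root_eq_cis by (simp add: DeMoivre complex_eq_iff)

lemma dft_root_mult_cnj: "dft_root p * cnj (dft_root p) = 1"
  unfolding dft_root_eq_cis by (simp add: cis_cnj cis_mult)

lemma dft_root_power_mod:
  assumes "0 < p" "a mod p = b mod p"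
  shows "dft_root p ^ a = dft_root p ^ b"
proof -
  have "dft_root p ^ a = dft_root p ^ (a mod p)" for a
    using dft_root_power_p[OF assms(1)]
    by (metis div_mult_mod_eq mult.commute mult_1 power_add power_mult power_one)
  then show ?thesis using assms(2) by metis
qed

text \<open>Primitivity is read off the real part: \<open>cos (2 * pi * c / p) = 1\<close> makes
  \<open>c / p\<close> an integer, which is impossible strictly between 0 and 1.\<close>

lemma dft_root_power_neq_1:
  assumes "0 < c" "c < p"
  shows "dft_root p ^ c \<noteq> 1"
proof
  assume "dft_root p ^ c = 1"
  then have "cis (- (2 * pi * real c / real p)) = 1"
    unfolding dft_root_eq_cis by (simp add: DeMoivre mult.commute)
  then have "cos (2 * pi * real c / real p) = 1" by (simp add: complex_eq_iff)
  then obtain x :: int where "2 * pi * real c / real p = of_int x * (2 * pi)"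
    unfolding cos_one_2pi_int by auto
  then have "real c = of_int x * real p" using assms by (simp add: field_simps)
  then have "int c = x * int p" by (metis of_int_eq_iff of_int_mult of_int_of_nat_eq)
  then have "int p dvd int c" by simp
  then show False using assms by (simp add: nat_dvd_not_less)
qed

lemma dft_root_power_mult_cnj:
  assumes "a < p" "b < p"
  shows "dft_root p ^ (a * l) * cnj (dft_root p) ^ (b * l) = dft_root p ^ (((a + p - b) mod p) * l)"
proof -
  have p: "0 < p" using assms by simp
  \<comment> \<open>Adding a full period writes \<open>a\<close> as \<open>b\<close> plus a natural
    number without truncated subtraction; the part with \<open>b\<close> then cancels against the
    conjugate.\<close>
  have "dft_root p ^ (a * l) = dft_root p ^ ((b + (a + p - b)) * l)"
    using assms by (intro dft_root_power_mod[OF p]) (simp add: distrib_right)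
  also have "\<dots> = dft_root p ^ (b * l) * dft_root p ^ ((a + p - b) * l)"
    by (simp add: distrib_right power_add del: add_diff_cancel_left)
  also have "dft_root p ^ ((a + p - b) * l) = dft_root p ^ (((a + p - b) mod p) * l)"
    by (intro dft_root_power_mod[OF p]) (simp add: mod_mult_left_eq)
  finally show ?thesis
    using dft_root_mult_cnj[of p]
    by (simp add: power_mult_distrib[symmetric] mult_ac)
qed

text \<open>A geometric sum whose ratio is a \<open>p\<close>-th root of unity: for ratio different
  from 1 the numerator vanishes. This is the orthogonality of the rows of the Fourier
  matrix.\<close>

lemma sum_dft_root_powers:
  assumes "c < p"
  shows "(\<Sum>l<p. dft_root p ^ (c * l)) = (if c = 0 then of_nat p else 0)"
proof (cases "c = 0")
  case False
  then have "dft_root p ^ c \<noteq> 1" using assms dft_root_power_neq_1 by auto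
  then have "(\<Sum>l<p. (dft_root p ^ c) ^ l) = ((dft_root p ^ c) ^ p - 1) / (dft_root p ^ c - 1)"
    by (rule geometric_sum)
  also have "(dft_root p ^ c) ^ p = 1"
    using assms dft_root_power_p[of p] by (metis less_nat_zero_code mult.commute neq0_conv power_mult power_one)
  finally show ?thesis using False by (simp add: power_mult)
qed simp

lemma dft_mat_carrier [simp]: "dft_mat p \<in> carrier_mat p p"
  unfolding dft_mat_def by simp

text \<open>The right side depends on \<open>a\<close> and \<open>b\<close> only through
  \<open>a - b\<close> modulo \<open>p\<close>; this is why Fourier conjugation of a block diagonal
  matrix is block circulant.\<close>

lemma dft_mat_mult_cnj:
  assumes "a < p" "b < p" "l < p"
  shows "dft_mat p $$ (a, l) * cnj (dft_mat p $$ (b, l)) = dft_root p ^ (((a + p - b) mod p) * l) / of_nat p"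
proof -
  have "dft_mat p $$ (a, l) * cnj (dft_mat p $$ (b, l)) =
      dft_root p ^ (a * l) * cnj (dft_root p) ^ (b * l) / of_real (sqrt (real p) * sqrt (real p))"
    using assms by (simp add: dft_mat_def dft_root_def del: real_sqrt_mult_self)
  then show ?thesis by (simp add: dft_root_power_mult_cnj[OF assms(1,2)])
qed

section \<open>Kronecker factors and Fourier block diagonal matrices\<close>

lemma kron_one_carrier [simp]: "A \<in> carrier_mat a b \<Longrightarrow> A \<otimes>\<^sub>K 1\<^sub>m m \<in> carrier_mat (m * a) (m * b)"
  unfolding kron_def by (auto simp: mult.commute intro!: carrier_matI)

lemma kron_one_index:
  assumes "A \<in> carrier_mat a b" "i < m * a" "j < m * b"
  shows "(A \<otimes>\<^sub>K 1\<^sub>m m) $$ (i, j) = (if i mod m = j mod m then A $$ (i div m, j div m) else 0)"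
  using assms div_less_of_less_mult[OF assms(2)] div_less_of_less_mult[OF assms(3)]
  unfolding kron_def by (auto simp: mult.commute)

lemma mat_adjoint_kron_one:
  assumes "A \<in> carrier_mat a b"
  shows "mat_adjoint (A \<otimes>\<^sub>K 1\<^sub>m m) = mat_adjoint A \<otimes>\<^sub>K 1\<^sub>m m"
proof (rule eq_matI)
  note c = kron_one_carrier[OF assms, of m] kron_one_carrier[OF mat_adjoint_carrier[OF assms], of m]
  show "dim_row (mat_adjoint (A \<otimes>\<^sub>K 1\<^sub>m m)) = dim_row (mat_adjoint A \<otimes>\<^sub>K 1\<^sub>m m)"
    "dim_col (mat_adjoint (A \<otimes>\<^sub>K 1\<^sub>m m)) = dim_col (mat_adjoint A \<otimes>\<^sub>K 1\<^sub>m m)" using c by auto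
  fix i j assume "i < dim_row (mat_adjoint A \<otimes>\<^sub>K 1\<^sub>m m)" "j < dim_col (mat_adjoint A \<otimes>\<^sub>K 1\<^sub>m m)"
  then have ij: "i < m * b" "j < m * a" using c by auto
  show "mat_adjoint (A \<otimes>\<^sub>K 1\<^sub>m m) $$ (i, j) = (mat_adjoint A \<otimes>\<^sub>K 1\<^sub>m m) $$ (i, j)"
    using carrier_matD[OF c(1)] ij assms kron_one_index[OF assms ij(2,1)] kron_one_index[OF mat_adjoint_carrier[OF assms] ij]
      div_less_of_less_mult[OF ij(1)] div_less_of_less_mult[OF ij(2)]
    by auto
qed

lemma fourier_block_diag_carrier:
  assumes "set Ds \<subseteq> carrier_mat m n" "length Ds = p"
  shows "fourier_block_diag m n p Ds \<in> carrier_mat (m * p) (n * p)"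
  using diag_block_mat_carrier[OF assms(1)] assms(2)
    kron_one_carrier[OF dft_mat_carrier] kron_one_carrier[OF mat_adjoint_carrier[OF dft_mat_carrier]]
  unfolding fourier_block_diag_def by (metis mult_carrier_mat)

lemma fourier_block_diag_index:
  assumes "set Ds \<subseteq> carrier_mat m n" "length Ds = p" "i < m * p" "j < n * p"
  shows "fourier_block_diag m n p Ds $$ (i, j) =
    (\<Sum>l<p. dft_mat p $$ (i div m, l) * cnj (dft_mat p $$ (j div n, l)) * Ds ! l $$ (i mod m, j mod n))"
proof -
  let ?F = "dft_mat p \<otimes>\<^sub>K 1\<^sub>m m" and ?G = "mat_adjoint (dft_mat p) \<otimes>\<^sub>K 1\<^sub>m n" and ?D = "diag_block_mat Ds"
  have F: "?F \<in> carrier_mat (m * p) (m * p)" by (rule kron_one_carrier[OF dft_mat_carrier])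
  have G: "?G \<in> carrier_mat (n * p) (n * p)"
    by (rule kron_one_carrier[OF mat_adjoint_carrier[OF dft_mat_carrier]])
  have D: "?D \<in> carrier_mat (m * p) (n * p)" using diag_block_mat_carrier[OF assms(1)] assms(2) by simp
  note i = div_less_of_less_mult[OF assms(3)] and j = div_less_of_less_mult[OF assms(4)]
  have FD: "(?F * ?D) $$ (i, r) = dft_mat p $$ (i div m, r div n) * Ds ! (r div n) $$ (i mod m, r mod n)"
    if r: "r < n * p" for r
  proof -
    note d = div_less_of_less_mult[OF r]
    have "(?F * ?D) $$ (i, r) = (\<Sum>s<m * p. ?F $$ (i, s) * ?D $$ (s, r))"
      by (rule index_mult_sum[OF F D assms(3) r])
    also have "\<dots> = (\<Sum>s<m * p. (if i mod m = s mod m then dft_mat p $$ (i div m, s div m) else 0) *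
        (if s div m = r div n then Ds ! (s div m) $$ (s mod m, r mod n) else 0))"
      using kron_one_index[OF dft_mat_carrier assms(3)] index_diag_block_mat[OF assms(1) _ , of _ r] r assms(2)
      by (intro sum.cong) auto
    \<comment> \<open>The index \<open>s\<close> is split into block \<open>l\<close> and offset
      \<open>q\<close>. The Kronecker factor fixes \<open>q\<close>, the block diagonal factor fixes
      \<open>l\<close>, and both sums collapse.\<close>
    also have "\<dots> = (\<Sum>l<p. \<Sum>q<m. (if i mod m = q then dft_mat p $$ (i div m, l) else 0) *
        (if l = r div n then Ds ! l $$ (q, r mod n) else 0))"
      by (rule sum_div_mod)
    also have "\<dots> = (\<Sum>l<p. if l = r div n then
        \<Sum>q<m. (if i mod m = q then dft_mat p $$ (i div m, l) else 0) * Ds ! l $$ (q, r mod n) else 0)"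
      by (rule sum.cong[OF refl]) simp
    also have "\<dots> = dft_mat p $$ (i div m, r div n) * Ds ! (r div n) $$ (i mod m, r mod n)"
      using d i by (simp add: if_distrib[of "\<lambda>x. x * _"] cong: if_cong)
    finally show ?thesis .
  qed
  have "fourier_block_diag m n p Ds $$ (i, j) = (\<Sum>r<n * p. (?F * ?D) $$ (i, r) * ?G $$ (r, j))"
    unfolding fourier_block_diag_def
    by (rule index_mult_sum[OF mult_carrier_mat[OF F D] G assms(3,4)])
  also have "\<dots> = (\<Sum>r<n * p. dft_mat p $$ (i div m, r div n) * Ds ! (r div n) $$ (i mod m, r mod n) *
      (if r mod n = j mod n then cnj (dft_mat p $$ (j div n, r div n)) else 0))"
    using FD kron_one_index[OF mat_adjoint_carrier[OF dft_mat_carrier] _ assms(4)] j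
      carrier_matD[OF dft_mat_carrier, of p] div_less_of_less_mult(1)[of _ n p]
    by (intro sum.cong) auto
  also have "\<dots> = (\<Sum>l<p. \<Sum>q<n. dft_mat p $$ (i div m, l) * Ds ! l $$ (i mod m, q) *
      (if q = j mod n then cnj (dft_mat p $$ (j div n, l)) else 0))"
    by (rule sum_div_mod)
  also have "\<dots> = (\<Sum>l<p. dft_mat p $$ (i div m, l) * cnj (dft_mat p $$ (j div n, l)) * Ds ! l $$ (i mod m, j mod n))"
    using j by (simp add: if_distrib[of "\<lambda>x. _ * x"] mult_ac cong: if_cong)
  finally show ?thesis .
qed

lemma fourier_block_diag_eq_bcirc:
  assumes "set Ds \<subseteq> carrier_mat m n" "length Ds = p" and p: "0 < p"
  obtains T where "T \<in> tensor_carrier m n p" "bcirc T = fourier_block_diag m n p Ds"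
proof
  \<comment> \<open>Slice \<open>k\<close> is the discrete Fourier transform of the blocks at
    frequency \<open>k\<close>; the divisor \<open>p\<close> collects the two factors
    \<open>1 / sqrt p\<close> of the Fourier matrix and its adjoint.\<close>
  define T where "T = map (\<lambda>k. mat m n (\<lambda>(i, j).
    \<Sum>l<p. dft_root p ^ (k * l) / of_nat p * Ds ! l $$ (i, j))) [0..<p]"
  show T: "T \<in> tensor_carrier m n p" unfolding T_def tensor_carrier_def by auto
  show "bcirc T = fourier_block_diag m n p Ds"
  proof (rule eq_matI)
    note c = bcirc_carrier[OF p T] fourier_block_diag_carrier[OF assms(1,2)]
    show "dim_row (bcirc T) = dim_row (fourier_block_diag m n p Ds)"
      "dim_col (bcirc T) = dim_col (fourier_block_diag m n p Ds)" using c by auto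
    fix i j assume "i < dim_row (fourier_block_diag m n p Ds)" "j < dim_col (fourier_block_diag m n p Ds)"
    then have ij: "i < m * p" "j < n * p" using c by auto
    note i = div_less_of_less_mult[OF ij(1)] and j = div_less_of_less_mult[OF ij(2)]
    show "bcirc T $$ (i, j) = fourier_block_diag m n p Ds $$ (i, j)"
      using i j p unfolding bcirc_index[OF p T ij] fourier_block_diag_index[OF assms(1,2) ij]
      by (simp add: T_def dft_mat_mult_cnj)
  qed
qed

lemma dft_kron_unitary:
  fixes n :: nat
  assumes p: "0 < p"
  defines "G \<equiv> dft_mat p \<otimes>\<^sub>K 1\<^sub>m n"
  shows "mat_adjoint G * G = 1\<^sub>m (n * p)"
proof -
  have G: "G \<in> carrier_mat (n * p) (n * p)" unfolding G_def by (rule kron_one_carrier[OF dft_mat_carrier])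
  \<comment> \<open>With identity blocks the Fourier block diagonal matrix is
    \<open>G * mat_adjoint G\<close>, so unitarity becomes a special case of its entry formula
    together with the orthogonality of the rows.\<close>
  let ?Ds = "replicate p (1\<^sub>m n :: complex mat)"
  have Ds: "set ?Ds \<subseteq> carrier_mat n n" by auto
  have "diag_block_mat ?Ds = 1\<^sub>m (n * p)"
    using diag_block_one_mat[of ?Ds] by (simp add: sum_list_replicate mult.commute)
  then have "G * mat_adjoint G = fourier_block_diag n n p ?Ds"
    using right_mult_one_mat[OF G] by (simp add: fourier_block_diag_def G_def mat_adjoint_kron_one[OF dft_mat_carrier])
  also have "\<dots> = 1\<^sub>m (n * p)"
  proof (rule eq_matI)
    note c = fourier_block_diag_carrier[OF Ds, of p]
    show "dim_row (fourier_block_diag n n p ?Ds) = dim_row (1\<^sub>m (n * p))"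
      "dim_col (fourier_block_diag n n p ?Ds) = dim_col (1\<^sub>m (n * p))" using c by auto
    fix i j assume "i < dim_row (1\<^sub>m (n * p) :: complex mat)" "j < dim_col (1\<^sub>m (n * p) :: complex mat)"
    then have ij: "i < n * p" "j < n * p" by auto
    note i = div_less_of_less_mult[OF ij(1)] and j = div_less_of_less_mult[OF ij(2)]
    define c where "c = (i div n + p - j div n) mod p"
    have "fourier_block_diag n n p ?Ds $$ (i, j)
        = (\<Sum>l<p. dft_root p ^ (c * l)) / of_nat p * (if i mod n = j mod n then 1 else 0)"
      using fourier_block_diag_index[OF Ds _ ij] i j
      by (simp add: dft_mat_mult_cnj c_def sum_divide_distrib)
    also have "\<dots> = (if c = 0 \<and> i mod n = j mod n then 1 else 0)"
      using sum_dft_root_powers[of c p] p by (simp add: c_def)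
    also have "c = 0 \<longleftrightarrow> i div n = j div n"
      using i j unfolding c_def by (auto simp: mod_less_twice)
    also have "(i div n = j div n \<and> i mod n = j mod n) \<longleftrightarrow> i = j"
      by (metis div_mult_mod_eq)
    finally show "fourier_block_diag n n p ?Ds $$ (i, j) = 1\<^sub>m (n * p) $$ (i, j)"
      using ij by simp
  qed
  finally show ?thesis
    by (rule mat_mult_left_right_inverse[OF G mat_adjoint_carrier[OF G]])
qed

text \<open>Conjugation only reflects the Fourier weights, since the blocks are real; reindexing the
  sum over frequencies moves the reflection from the weights to the blocks.\<close>

lemma fourier_block_diag_cnj:
  assumes Ds: "set Ds \<subseteq> carrier_mat m n" "length Ds = p" and p: "0 < p"
    and real: "\<And>D. D \<in> set Ds \<Longrightarrow> map_mat cnj D = D"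
  shows "map_mat cnj (fourier_block_diag m n p Ds) =
    fourier_block_diag m n p (map (\<lambda>k. Ds ! ((p - k) mod p)) [0..<p])"
    (is "_ = fourier_block_diag m n p ?Es")
proof (rule eq_matI)
  have Es: "set ?Es \<subseteq> carrier_mat m n" "length ?Es = p"
    using Ds p by (auto intro!: subsetD[OF Ds(1)] nth_mem)
  note c = fourier_block_diag_carrier[OF Ds] fourier_block_diag_carrier[OF Es]
  show "dim_row (map_mat cnj (fourier_block_diag m n p Ds)) = dim_row (fourier_block_diag m n p ?Es)"
    "dim_col (map_mat cnj (fourier_block_diag m n p Ds)) = dim_col (fourier_block_diag m n p ?Es)"
    using c by auto
  fix i j assume "i < dim_row (fourier_block_diag m n p ?Es)" "j < dim_col (fourier_block_diag m n p ?Es)"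
  then have ij: "i < m * p" "j < n * p" using c by auto
  note i = div_less_of_less_mult[OF ij(1)] and j = div_less_of_less_mult[OF ij(2)]
  define a where "a = (i div m + p - j div n) mod p"
  have D: "cnj (Ds ! l $$ (i mod m, j mod n)) = Ds ! l $$ (i mod m, j mod n)" if "l < p" for l
  proof -
    have l: "Ds ! l \<in> set Ds" using that Ds(2) by simp
    then have "Ds ! l \<in> carrier_mat m n" using Ds(1) by auto
    with real[OF l] i j show ?thesis by (metis carrier_matD index_map_mat(1))
  qed
  \<comment> \<open>Both sides are inverse to \<open>dft_root p ^ (a * l)\<close>, hence
    equal.\<close>
  have root: "cnj (dft_root p ^ (a * l)) = dft_root p ^ (a * ((p - l) mod p))" if "l < p" for l
  proof -
    have "dft_root p ^ (a * ((p - l) mod p)) = dft_root p ^ (a * (p - l))"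
      by (intro dft_root_power_mod[OF p]) (simp add: mod_mult_right_eq)
    moreover have "dft_root p ^ (a * (p - l)) * dft_root p ^ (a * l) = 1"
    proof -
      have "a * (p - l) + a * l = a * p" using that by (simp flip: distrib_left)
      then have "dft_root p ^ (a * (p - l)) * dft_root p ^ (a * l) = dft_root p ^ (a * p)"
        by (simp only: power_add[symmetric])
      also have "\<dots> = dft_root p ^ 0" by (rule dft_root_power_mod[OF p]) simp
      finally show ?thesis by simp
    qed
    moreover have "dft_root p ^ (a * l) * cnj (dft_root p ^ (a * l)) = 1"
      using dft_root_mult_cnj[of p] by (simp add: power_mult_distrib[symmetric])
    ultimately show ?thesis by (metis mult.assoc mult.left_neutral mult.right_neutral)
  qed
  \<comment> \<open>The reflection is its own inverse, so it serves as both maps in the reindexing.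
    The outer \<open>mod p\<close> brings \<open>p - 0\<close> back into range and keeps frequency 0
    fixed.\<close>
  have neg: "(p - l) mod p < p" "(p - (p - l) mod p) mod p = l" if "l < p" for l
    using that by (cases "l = 0"; simp)+
  have "map_mat cnj (fourier_block_diag m n p Ds) $$ (i, j) =
      (\<Sum>l<p. dft_root p ^ (a * ((p - l) mod p)) / of_nat p * Ds ! l $$ (i mod m, j mod n))"
    using c ij fourier_block_diag_index[OF Ds ij] i j D root
    by (simp add: dft_mat_mult_cnj a_def del: complex_cnj_power)
  also have "\<dots> = (\<Sum>l<p. dft_root p ^ (a * l) / of_nat p * Ds ! ((p - l) mod p) $$ (i mod m, j mod n))"
    by (rule sum.reindex_bij_witness[where i = "\<lambda>l. (p - l) mod p" and j = "\<lambda>l. (p - l) mod p"])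
      (simp_all add: neg)
  also have "\<dots> = fourier_block_diag m n p ?Es $$ (i, j)"
    using fourier_block_diag_index[OF Es ij] i j by (simp add: dft_mat_mult_cnj a_def)
  finally show "map_mat cnj (fourier_block_diag m n p Ds) $$ (i, j) = fourier_block_diag m n p ?Es $$ (i, j)" .
qed

subsection \<open>Invariance of the generalized function\<close>

lemma t_svdD:
  assumes "t_svd m n p A U S V \<Sigma>s"
  shows "t_unitary m p U" "t_unitary n p V" "S \<in> tensor_carrier m n p" "A = U *\<^sub>T S *\<^sub>T t_adjoint V"
    "length \<Sigma>s = p" "set \<Sigma>s \<subseteq> carrier_mat m n"
    "bcirc S = fourier_block_diag m n p (map (map_mat complex_of_real) \<Sigma>s)"
  using assms unfolding t_svd_def by auto

lemma f_hat_carrier_bcirc: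
  assumes p: "0 < p" and "length \<Sigma>s = p" "set \<Sigma>s \<subseteq> carrier_mat m n"
  shows "f_hat m n p f \<Sigma>s \<in> tensor_carrier m n p"
    "bcirc (f_hat m n p f \<Sigma>s) = fourier_block_diag m n p (map (f_tilde f) \<Sigma>s)"
proof -
  have "set (map (f_tilde f) \<Sigma>s) \<subseteq> carrier_mat m n" "length (map (f_tilde f) \<Sigma>s) = p"
    using assms by (auto simp: f_tilde_def)
  from fourier_block_diag_eq_bcirc[OF this p]
  have "fourier_block_diag m n p (map (f_tilde f) \<Sigma>s) \<in> bcirc ` tensor_carrier m n p" by (metis imageI)
  then show "f_hat m n p f \<Sigma>s \<in> tensor_carrier m n p"
    "bcirc (f_hat m n p f \<Sigma>s) = fourier_block_diag m n p (map (f_tilde f) \<Sigma>s)"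
    unfolding f_hat_def bcirc_inv_def by (auto intro: inv_into_into f_inv_into_f)
qed

lemma gen_fun_value_carrier:
  assumes p: "0 < p" and "gen_fun_value m n p f A B"
  shows "B \<in> tensor_carrier m n p"
proof -
  from assms obtain U S V \<Sigma>s where svd: "t_svd m n p A U S V \<Sigma>s"
    and B: "B = U *\<^sub>T f_hat m n p f \<Sigma>s *\<^sub>T t_adjoint V"
    unfolding gen_fun_value_def by auto
  note d = t_svdD[OF svd]
  show ?thesis unfolding B
    using t_prod_carrier[OF p t_prod_carrier[OF p t_unitaryD(1)[OF d(1)] f_hat_carrier_bcirc(1)[OF p d(5,6)]]
      t_adjoint_carrier[OF t_unitaryD(1)[OF d(2)]]] .
qed

lemma gen_fun_value_gen_fun:
  assumes "gen_fun_well_defined m n p f A"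
  shows "gen_fun_value m n p f A (gen_fun m n p f A)"
  using assms theI'[of "gen_fun_value m n p f A"] unfolding gen_fun_well_defined_def gen_fun_def by auto

lemma gen_fun_unique:
  assumes "gen_fun_well_defined m n p f A" "gen_fun_value m n p f A B"
  shows "B = gen_fun m n p f A"
  using assms gen_fun_value_gen_fun[OF assms(1)] unfolding gen_fun_well_defined_def by auto

lemma t_sandwich_assoc:
  assumes p: "0 < p" and P: "P \<in> tensor_carrier m m p" and U: "U \<in> tensor_carrier m m p"
    and X: "X \<in> tensor_carrier m n p" and V: "V \<in> tensor_carrier n n p" and Q: "Q \<in> tensor_carrier n n p"
  shows "(P *\<^sub>T U) *\<^sub>T X *\<^sub>T t_adjoint (Q *\<^sub>T V) = P *\<^sub>T (U *\<^sub>T X *\<^sub>T t_adjoint V) *\<^sub>T t_adjoint Q"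
proof -
  note V' = t_adjoint_carrier[OF V] and Q' = t_adjoint_carrier[OF Q]
  note UX = t_prod_carrier[OF p U X]
  have "(P *\<^sub>T U) *\<^sub>T X *\<^sub>T t_adjoint (Q *\<^sub>T V) = P *\<^sub>T (U *\<^sub>T X) *\<^sub>T (t_adjoint V *\<^sub>T t_adjoint Q)"
    by (simp only: t_adjoint_prod[OF p Q V] t_prod_assoc[OF p P U X])
  also have "\<dots> = P *\<^sub>T (U *\<^sub>T X) *\<^sub>T t_adjoint V *\<^sub>T t_adjoint Q"
    by (rule t_prod_assoc[OF p t_prod_carrier[OF p P UX] V' Q', symmetric])
  also have "\<dots> = P *\<^sub>T (U *\<^sub>T X *\<^sub>T t_adjoint V) *\<^sub>T t_adjoint Q"
    by (simp only: t_prod_assoc[OF p P UX V'])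
  finally show ?thesis .
qed

lemma gen_fun_value_unitary:
  assumes p: "0 < p" and P: "t_unitary m p P" and Q: "t_unitary n p Q"
    and val: "gen_fun_value m n p f A B"
  shows "gen_fun_value m n p f (P *\<^sub>T A *\<^sub>T t_adjoint Q) (P *\<^sub>T B *\<^sub>T t_adjoint Q)"
proof -
  from val obtain U S V \<Sigma>s where svd: "t_svd m n p A U S V \<Sigma>s"
    and B: "B = U *\<^sub>T f_hat m n p f \<Sigma>s *\<^sub>T t_adjoint V"
    unfolding gen_fun_value_def by auto
  note d = t_svdD[OF svd]
  note assoc = t_sandwich_assoc[OF p t_unitaryD(1)[OF P] t_unitaryD(1)[OF d(1)] _ t_unitaryD(1)[OF d(2)] t_unitaryD(1)[OF Q]]
  have "t_svd m n p (P *\<^sub>T A *\<^sub>T t_adjoint Q) (P *\<^sub>T U) S (Q *\<^sub>T V) \<Sigma>s"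
    using svd t_unitary_mult[OF p P d(1)] t_unitary_mult[OF p Q d(2)] assoc[OF d(3)]
    unfolding t_svd_def by simp
  moreover have "P *\<^sub>T B *\<^sub>T t_adjoint Q = (P *\<^sub>T U) *\<^sub>T f_hat m n p f \<Sigma>s *\<^sub>T t_adjoint (Q *\<^sub>T V)"
    unfolding B by (rule assoc[OF f_hat_carrier_bcirc(1)[OF p d(5,6)], symmetric])
  ultimately show ?thesis unfolding gen_fun_value_def by blast
qed

lemma gen_fun_invariant:
  assumes "0 < p" "gen_fun_well_defined m n p f A" "t_unitary m p P" "t_unitary n p Q"
    and "P *\<^sub>T A *\<^sub>T t_adjoint Q = A"
  shows "P *\<^sub>T gen_fun m n p f A *\<^sub>T t_adjoint Q = gen_fun m n p f A"
  using gen_fun_unique[OF assms(2)] gen_fun_value_unitary[OF assms(1,3,4) gen_fun_value_gen_fun[OF assms(2)]]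
  unfolding assms(5) by blast

lemma gen_fun_value_cnj:
  assumes p: "0 < p" and val: "gen_fun_value m n p f A B"
    and real: "\<And>\<sigma>. \<sigma> \<in> t_singular_values m n p A \<Longrightarrow> 0 < \<sigma> \<Longrightarrow> f (complex_of_real \<sigma>) \<in> \<real>"
  shows "gen_fun_value m n p f (t_cnj A) (t_cnj B)"
proof -
  from val obtain U S V \<Sigma>s where svd: "t_svd m n p A U S V \<Sigma>s"
    and B: "B = U *\<^sub>T f_hat m n p f \<Sigma>s *\<^sub>T t_adjoint V"
    unfolding gen_fun_value_def by auto
  note d = t_svdD[OF svd]
  define \<Sigma>s' where "\<Sigma>s' = map (\<lambda>k. \<Sigma>s ! ((p - k) mod p)) [0..<p]"
  have sub: "set \<Sigma>s' \<subseteq> set \<Sigma>s" and len: "length \<Sigma>s' = p"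
    using p d(5) by (auto simp: \<Sigma>s'_def)
  \<comment> \<open>Reflecting the list commutes with applying a function to each block, so one
    conjugation lemma treats \<open>S\<close> and the middle factor of the value alike.\<close>
  have map: "map h \<Sigma>s' = map (\<lambda>k. map h \<Sigma>s ! ((p - k) mod p)) [0..<p]" for h :: "real mat \<Rightarrow> complex mat"
    using p d(5) by (simp add: \<Sigma>s'_def)
  note fh = f_hat_carrier_bcirc[OF p d(5,6)] and fh' = f_hat_carrier_bcirc[OF p len subset_trans[OF sub d(6)]]
  have cnj_real: "map_mat cnj (map_mat complex_of_real M) = map_mat complex_of_real M" for M
    by (rule eq_matI) auto
  have S: "bcirc (t_cnj S) = fourier_block_diag m n p (map (map_mat complex_of_real) \<Sigma>s')"
    unfolding bcirc_cnj[OF p d(3)] d(7) map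
    by (rule fourier_block_diag_cnj) (use p d(5,6) cnj_real in auto)
  \<comment> \<open>Off the diagonal the entries are 0 and \<open>f_tilde\<close> keeps them 0. On
    the diagonal they are singular values of \<open>A\<close>, which is where reality of
    \<open>f\<close> is available.\<close>
  have cnj_tilde: "map_mat cnj (f_tilde f M) = f_tilde f M" if M: "M \<in> set \<Sigma>s" for M
  proof (rule eq_matI)
    fix i j assume "i < dim_row (f_tilde f M)" "j < dim_col (f_tilde f M)"
    moreover have Mc: "M \<in> carrier_mat m n" using M d(6) by auto
    ultimately have ij: "i < m" "j < n" by (auto simp: f_tilde_def)
    have "diagonal_mat M" using svd M unfolding t_svd_def by blast
    then have "M $$ (i, j) = 0" if "i \<noteq> j"
      using ij that Mc unfolding diagonal_mat_def by auto
    moreover have "M $$ (i, i) \<in> t_singular_values m n p A" if "i = j"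
    proof -
      have "i < min m n" using ij that by simp
      with svd M have "\<exists>U S V \<Sigma>s. t_svd m n p A U S V \<Sigma>s \<and> M \<in> set \<Sigma>s \<and> i < min m n"
        by (intro exI conjI)
      then show ?thesis
        unfolding t_singular_values_def by (intro CollectI exI[of _ M] exI[of _ i] conjI refl)
    qed
    ultimately show "map_mat cnj (f_tilde f M) $$ (i, j) = f_tilde f M $$ (i, j)"
      using ij Mc real[of "M $$ (i, i)"] by (cases "i = j") (auto simp: f_tilde_def Reals_cnj_iff)
  qed auto
  have tilde_carrier: "f_tilde f M \<in> carrier_mat m n" if "M \<in> set \<Sigma>s" for M
    using that d(6) by (auto simp: f_tilde_def)
  have "t_cnj (f_hat m n p f \<Sigma>s) = f_hat m n p f \<Sigma>s'"
  proof (rule bcirc_inj[OF p t_cnj_carrier[OF fh(1)] fh'(1)])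
    show "bcirc (t_cnj (f_hat m n p f \<Sigma>s)) = bcirc (f_hat m n p f \<Sigma>s')"
      unfolding bcirc_cnj[OF p fh(1)] fh(2) fh'(2) map
      by (rule fourier_block_diag_cnj) (use p d(5) cnj_tilde tilde_carrier in auto)
  qed
  moreover have cnj3: "t_cnj (U *\<^sub>T X *\<^sub>T t_adjoint V) = t_cnj U *\<^sub>T t_cnj X *\<^sub>T t_adjoint (t_cnj V)"
    if X: "X \<in> tensor_carrier m n p" for X
    using t_cnj_prod[OF p t_prod_carrier[OF p t_unitaryD(1)[OF d(1)] X] t_adjoint_carrier[OF t_unitaryD(1)[OF d(2)]]]
      t_cnj_prod[OF p t_unitaryD(1)[OF d(1)] X] t_cnj_adjoint[OF t_unitaryD(1)[OF d(2)]] by simp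
  ultimately have cnj_B: "t_cnj B = t_cnj U *\<^sub>T f_hat m n p f \<Sigma>s' *\<^sub>T t_adjoint (t_cnj V)"
    unfolding B using fh(1) by simp
  have "F_diagonal S" using svd unfolding t_svd_def by blast
  then have "F_diagonal (t_cnj S)"
    unfolding F_diagonal_def t_cnj_def diagonal_mat_def by simp
  moreover have "\<forall>M \<in> set \<Sigma>s'. M \<in> carrier_mat m n \<and> diagonal_mat M \<and> (\<forall>i<m. \<forall>j<n. 0 \<le> M $$ (i, j))"
    using svd sub unfolding t_svd_def by (meson subsetD)
  ultimately have "t_svd m n p (t_cnj A) (t_cnj U) (t_cnj S) (t_cnj V) \<Sigma>s'"
    using S len cnj3[OF d(3), folded d(4)] t_unitary_cnj[OF p d(1)] t_unitary_cnj[OF p d(2)] t_cnj_carrier[OF d(3)]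
    unfolding t_svd_def by - (intro conjI; assumption)
  with cnj_B show ?thesis unfolding gen_fun_value_def by blast
qed

lemma t_adjoint_id: "0 < p \<Longrightarrow> t_adjoint (t_id n p) = t_id n p"
  by (simp add: t_id_eq_const t_adjoint_const)

text \<open>The double adjoint is left in place so that both identities match
  \<open>gen_fun_value_unitary\<close> applied to \<open>t_adjoint P\<close> and
  \<open>t_adjoint Q\<close>.\<close>

lemma t_unitary_cancel:
  assumes p: "0 < p" and P: "t_unitary m p P" and Q: "t_unitary n p Q" and X: "X \<in> tensor_carrier m n p"
  shows "t_adjoint P *\<^sub>T (P *\<^sub>T X *\<^sub>T t_adjoint Q) *\<^sub>T t_adjoint (t_adjoint Q) = X"
    and "P *\<^sub>T (t_adjoint P *\<^sub>T X *\<^sub>T t_adjoint (t_adjoint Q)) *\<^sub>T t_adjoint Q = X"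
proof -
  note P' = t_unitaryD[OF P] and Q' = t_unitaryD[OF Q]
  note aP = t_adjoint_carrier[OF P'(1)] and aQ = t_adjoint_carrier[OF Q'(1)]
  show "t_adjoint P *\<^sub>T (P *\<^sub>T X *\<^sub>T t_adjoint Q) *\<^sub>T t_adjoint (t_adjoint Q) = X"
    using t_sandwich_assoc[OF p aP P'(1) X Q'(1) aQ] P' Q' p X
    by (simp add: t_adjoint_id)
  show "P *\<^sub>T (t_adjoint P *\<^sub>T X *\<^sub>T t_adjoint (t_adjoint Q)) *\<^sub>T t_adjoint Q = X"
    using t_sandwich_assoc[OF p P'(1) aP X aQ Q'(1)] P' Q' p X
    by (simp add: t_adjoint_id)
qed

lemma t_unitary_adjoint: "0 < p \<Longrightarrow> t_unitary n p Q \<Longrightarrow> t_unitary n p (t_adjoint Q)"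
  unfolding t_unitary_def using t_adjoint_adjoint[of p Q n n] by simp

lemma gen_fun_cnj_invariant:
  assumes p: "0 < p" and wd: "gen_fun_well_defined m n p f A" and A: "A \<in> tensor_carrier m n p"
    and P: "t_unitary m p P" and Q: "t_unitary n p Q"
    and real: "\<And>\<sigma>. \<sigma> \<in> t_singular_values m n p A \<Longrightarrow> 0 < \<sigma> \<Longrightarrow> f (complex_of_real \<sigma>) \<in> \<real>"
    and eq: "P *\<^sub>T A *\<^sub>T t_adjoint Q = t_cnj A"
  shows "P *\<^sub>T gen_fun m n p f A *\<^sub>T t_adjoint Q = t_cnj (gen_fun m n p f A)"
proof -
  let ?B = "gen_fun m n p f A"
  note val = gen_fun_value_gen_fun[OF wd]
  \<comment> \<open>Uniqueness is known at \<open>A\<close> only, not at its conjugate. The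
    conjugated value is therefore pulled back along the adjoint unitaries to a value at
    \<open>A\<close>, and the resulting equation is solved afterwards.\<close>
  have "gen_fun_value m n p f (t_adjoint P *\<^sub>T t_cnj A *\<^sub>T t_adjoint (t_adjoint Q))
      (t_adjoint P *\<^sub>T t_cnj ?B *\<^sub>T t_adjoint (t_adjoint Q))"
    by (rule gen_fun_value_unitary[OF p t_unitary_adjoint[OF p P] t_unitary_adjoint[OF p Q]
          gen_fun_value_cnj[OF p val real]])
  then have "t_adjoint P *\<^sub>T t_cnj ?B *\<^sub>T t_adjoint (t_adjoint Q) = ?B"
    by (intro gen_fun_unique[OF wd]) (simp only: t_unitary_cancel(1)[OF p P Q A, unfolded eq])
  then show ?thesis
    using t_unitary_cancel(2)[OF p P Q t_cnj_carrier[OF gen_fun_value_carrier[OF p val]]] by simp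
qed

lemma gen_fun_carrier:
  assumes "0 < p" "gen_fun_well_defined m n p f A"
  shows "gen_fun m n p f A \<in> tensor_carrier m n p"
  using gen_fun_value_carrier[OF assms(1) gen_fun_value_gen_fun[OF assms(2)]] .

subsection \<open>Permutation tensors and circulant structure\<close>

text \<open>Row \<open>i\<close> has its one in column \<open>\<pi> i\<close>, so that conjugation
  by this matrix substitutes \<open>\<pi>\<close>, not its inverse, into both indices.\<close>

definition perm_mat :: "nat \<Rightarrow> (nat \<Rightarrow> nat) \<Rightarrow> complex mat" where
  "perm_mat n \<pi> = mat n n (\<lambda>(i, j). if j = \<pi> i then 1 else 0)"

lemma perm_mat_carrier [simp]: "perm_mat n \<pi> \<in> carrier_mat n n"
  unfolding perm_mat_def by simp

lemma perm_mat_sandwich_index: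
  assumes "X \<in> carrier_mat n n" "\<pi> ` {..<n} \<subseteq> {..<n}" "i < n" "j < n"
  shows "(perm_mat n \<pi> * X * mat_adjoint (perm_mat n \<pi>)) $$ (i, j) = X $$ (\<pi> i, \<pi> j)"
proof -
  note c = perm_mat_carrier[of n \<pi>]
  have \<pi>: "\<pi> i < n" "\<pi> j < n" using assms by auto
  have PX: "(perm_mat n \<pi> * X) $$ (i, q) = X $$ (\<pi> i, q)" if "q < n" for q
  proof -
    have "(perm_mat n \<pi> * X) $$ (i, q) = (\<Sum>r<n. if r = \<pi> i then X $$ (r, q) else 0)"
      unfolding index_mult_sum[OF c assms(1,3) that] using assms(3) by (intro sum.cong) (auto simp: perm_mat_def)
    then show ?thesis using \<pi> by simp
  qed
  have "(perm_mat n \<pi> * X * mat_adjoint (perm_mat n \<pi>)) $$ (i, j)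
      = (\<Sum>q<n. if q = \<pi> j then X $$ (\<pi> i, q) else 0)"
    unfolding index_mult_sum[OF mult_carrier_mat[OF c assms(1)] mat_adjoint_carrier[OF c] assms(3,4)]
    using PX assms(4) by (intro sum.cong)
      (auto simp: perm_mat_def simp del: index_mult_mat(1))
  then show ?thesis using \<pi> by simp
qed

lemma perm_mat_unitary:
  assumes "\<pi> ` {..<n} \<subseteq> {..<n}" "inj_on \<pi> {..<n}"
  shows "mat_adjoint (perm_mat n \<pi>) * perm_mat n \<pi> = 1\<^sub>m n"
proof -
  note c = perm_mat_carrier[of n \<pi>]
  \<comment> \<open>The identity matrix is inserted to make the sandwich formula applicable: the
    entry is 1 exactly if \<open>\<pi> i = \<pi> j\<close>, which injectivity turns into
    \<open>i = j\<close>.\<close>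
  have "perm_mat n \<pi> * 1\<^sub>m n * mat_adjoint (perm_mat n \<pi>) = 1\<^sub>m n"
  proof (rule eq_matI)
    fix i j assume "i < dim_row (1\<^sub>m n :: complex mat)" "j < dim_col (1\<^sub>m n :: complex mat)"
    then have ij: "i < n" "j < n" by auto
    then have "\<pi> i < n" "\<pi> j < n" using assms(1) by auto
    moreover have "\<pi> i = \<pi> j \<longleftrightarrow> i = j" using assms(2) ij by (auto dest: inj_onD)
    ultimately show "(perm_mat n \<pi> * 1\<^sub>m n * mat_adjoint (perm_mat n \<pi>)) $$ (i, j) = 1\<^sub>m n $$ (i, j)"
      using perm_mat_sandwich_index[OF one_carrier_mat assms(1) ij] ij by simp
  qed (use carrier_matD[OF c] in auto)
  then have "perm_mat n \<pi> * mat_adjoint (perm_mat n \<pi>) = 1\<^sub>m n"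
    using right_mult_one_mat[OF c] by simp
  then show ?thesis by (rule mat_mult_left_right_inverse[OF c mat_adjoint_carrier[OF c]])
qed

definition perm_invariant :: "nat \<Rightarrow> (nat \<Rightarrow> nat) \<Rightarrow> complex mat \<Rightarrow> bool" where
  "perm_invariant n \<pi> X \<longleftrightarrow> (\<forall>i<n. \<forall>j<n. X $$ (\<pi> i, \<pi> j) = X $$ (i, j))"

text \<open>A tensor supported on its first slice acts on each slice separately. The equivalence is
  used in both directions: to express the structure of \<open>A\<close> as a symmetry, and to read
  the symmetry of the value slice by slice.\<close>

lemma t_perm_sandwich_eq_iff:
  assumes p: "0 < p" and A: "A \<in> tensor_carrier n n p" and \<pi>: "\<pi> ` {..<n} \<subseteq> {..<n}"
  defines "P \<equiv> t_const p (perm_mat n \<pi>)"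
  shows "P *\<^sub>T A *\<^sub>T t_adjoint P = A \<longleftrightarrow> (\<forall>X \<in> set A. perm_invariant n \<pi> X)"
proof -
  note c = perm_mat_carrier[of n \<pi>]
  have "P *\<^sub>T A *\<^sub>T t_adjoint P = map (\<lambda>X. perm_mat n \<pi> * X * mat_adjoint (perm_mat n \<pi>)) A"
    using t_const_mult[OF p c A] mult_t_const[OF p t_prod_carrier[OF p t_const_carrier[OF p c] A] mat_adjoint_carrier[OF c]]
    by (simp add: P_def t_adjoint_const[OF p])
  then have "P *\<^sub>T A *\<^sub>T t_adjoint P = A \<longleftrightarrow>
      (\<forall>X \<in> set A. perm_mat n \<pi> * X * mat_adjoint (perm_mat n \<pi>) = X)"
    using map_eq_conv[of "\<lambda>X. perm_mat n \<pi> * X * mat_adjoint (perm_mat n \<pi>)" A id] by simp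
  also have "\<dots> \<longleftrightarrow> (\<forall>X \<in> set A. perm_invariant n \<pi> X)"
  proof (rule ball_cong[OF refl])
    fix X assume "X \<in> set A"
    then have X: "X \<in> carrier_mat n n" using A unfolding tensor_carrier_def by auto
    show "perm_mat n \<pi> * X * mat_adjoint (perm_mat n \<pi>) = X \<longleftrightarrow> perm_invariant n \<pi> X"
    proof
      assume "perm_mat n \<pi> * X * mat_adjoint (perm_mat n \<pi>) = X"
      then show "perm_invariant n \<pi> X"
        using perm_mat_sandwich_index[OF X \<pi>] unfolding perm_invariant_def by simp
    next
      assume inv: "perm_invariant n \<pi> X"
      show "perm_mat n \<pi> * X * mat_adjoint (perm_mat n \<pi>) = X"
        by (rule eq_matI)
          (use perm_mat_sandwich_index[OF X \<pi>] inv X carrier_matD[OF c] in \<open>auto simp: perm_invariant_def simp del: index_mult_mat(1)\<close>)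
    qed
  qed
  finally show ?thesis .
qed

lemma gen_fun_perm_invariant:
  assumes p: "0 < p" and wd: "gen_fun_well_defined n n p f A" and A: "A \<in> tensor_carrier n n p"
    and \<pi>: "\<pi> ` {..<n} \<subseteq> {..<n}" "inj_on \<pi> {..<n}"
    and inv: "\<And>X. X \<in> set A \<Longrightarrow> perm_invariant n \<pi> X"
    and X: "X \<in> set (gen_fun n n p f A)"
  shows "perm_invariant n \<pi> X"
proof -
  let ?P = "t_const p (perm_mat n \<pi>)"
  have u: "t_unitary n p ?P" by (rule t_unitary_const[OF p perm_mat_carrier perm_mat_unitary[OF \<pi>]])
  have "?P *\<^sub>T A *\<^sub>T t_adjoint ?P = A" using t_perm_sandwich_eq_iff[OF p A \<pi>(1)] inv by simp
  from gen_fun_invariant[OF p wd u u this]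
  show ?thesis using t_perm_sandwich_eq_iff[OF p gen_fun_carrier[OF p wd] \<pi>(1)] X by simp
qed

section \<open>Cyclic shifts and circulant matrices\<close>

lemma shift_invariant_iterate:
  fixes g :: "nat \<Rightarrow> nat \<Rightarrow> 'a"
  assumes "\<And>i j. i < n \<Longrightarrow> j < n \<Longrightarrow> g (Suc i mod n) (Suc j mod n) = g i j" "i < n" "j < n"
  shows "g ((i + t) mod n) ((j + t) mod n) = g i j"
proof (induction t)
  case (Suc t)
  have "g ((i + Suc t) mod n) ((j + Suc t) mod n) = g (Suc ((i + t) mod n) mod n) (Suc ((j + t) mod n) mod n)"
    by (simp add: mod_Suc_eq)
  also have "\<dots> = g ((i + t) mod n) ((j + t) mod n)" using assms by (intro assms(1)) auto
  finally show ?case using Suc by simp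
qed (use assms in simp)

text \<open>Shifting \<open>n - j\<close> times brings column \<open>j\<close> to column 0 and row
  \<open>i\<close> to row \<open>i - j\<close> modulo \<open>n\<close>.\<close>

lemma shift_invariant_difference:
  fixes g :: "nat \<Rightarrow> nat \<Rightarrow> 'a"
  assumes "\<And>i j. i < n \<Longrightarrow> j < n \<Longrightarrow> g (Suc i mod n) (Suc j mod n) = g i j" "i < n" "j < n"
  shows "g i j = g ((i + n - j) mod n) 0"
  using shift_invariant_iterate[of n g i j "n - j"] assms by simp

lemma shift_difference:
  fixes i j n :: nat
  assumes "i < n" "j < n"
  shows "(Suc i mod n + n - Suc j mod n) mod n = (i + n - j) mod n"
proof -
  have "Suc x mod n = (if Suc x < n then Suc x else 0)" if "x < n" for x
    using that by (auto simp: mod_less_twice le_less_Suc_eq not_less dest: le_antisym)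
  then show ?thesis using assms by (auto simp: mod_less_twice)
qed

text \<open>One step of the shift suffices: by iteration every entry equals one in the first column,
  and this column is the generating function \<open>c\<close>. Conversely the shift leaves the
  difference of the indices unchanged, including at the wrap-around.\<close>

lemma circulant_mat_iff:
  "circulant_mat n C \<longleftrightarrow> C \<in> carrier_mat n n \<and> perm_invariant n (\<lambda>i. Suc i mod n) C"
proof (intro iffI conjI)
  assume "circulant_mat n C"
  then obtain c where "C \<in> carrier_mat n n" and c: "\<And>i j. i < n \<Longrightarrow> j < n \<Longrightarrow> C $$ (i, j) = c ((i + n - j) mod n)"
    unfolding circulant_mat_def by blast
  then show "C \<in> carrier_mat n n" "perm_invariant n (\<lambda>i. Suc i mod n) C"
    by (auto simp: perm_invariant_def shift_difference c)
next
  assume C: "C \<in> carrier_mat n n \<and> perm_invariant n (\<lambda>i. Suc i mod n) C"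
  then have "C $$ (i, j) = C $$ ((i + n - j) mod n, 0)" if "i < n" "j < n" for i j
    using shift_invariant_difference[of n "\<lambda>i j. C $$ (i, j)" i j] that by (auto simp: perm_invariant_def)
  with C show "circulant_mat n C"
    unfolding circulant_mat_def by (intro conjI exI[of _ "\<lambda>r. C $$ (r, 0)"]) blast+
qed

text \<open>With indices written as \<open>a * k + i\<close>, block \<open>a\<close> and offset
  \<open>i\<close>, this shift and \<open>inner_shift\<close> generate an action of the product of
  the cyclic groups of orders \<open>N\<close> and \<open>k\<close>. Block circulant matrices with
  circulant blocks are the matrices invariant under it.\<close>

definition outer_shift :: "nat \<Rightarrow> nat \<Rightarrow> nat \<Rightarrow> nat" where
  "outer_shift N k i = (Suc (i div k) mod N) * k + i mod k"

definition inner_shift :: "nat \<Rightarrow> nat \<Rightarrow> nat" where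
  "inner_shift k i = (i div k) * k + Suc (i mod k) mod k"

lemma Suc_mod_inj:
  assumes "Suc a mod n = Suc b mod n" "a < n" "b < n"
  shows "a = b"
proof -
  have "Suc x mod n = (if Suc x < n then Suc x else 0)" if "x < n" for x
    using that by (auto simp: mod_less_twice le_less_Suc_eq not_less dest: le_antisym)
  then show ?thesis using assms by (auto split: if_splits)
qed

text \<open>Quotient and remainder by \<open>k\<close> recover block and offset, so injectivity
  reduces to that of the successor modulo \<open>N\<close>.\<close>

lemma outer_shift_permutes:
  "outer_shift N k ` {..<N * k} \<subseteq> {..<N * k}" "inj_on (outer_shift N k) {..<N * k}"
proof -
  have d: "x div k < N" "x mod k < k" if "x < N * k" for x
    using div_less_of_less_mult[of x k N] that by (simp_all add: mult.commute)
  show "outer_shift N k ` {..<N * k} \<subseteq> {..<N * k}"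
  proof (rule image_subsetI)
    fix x assume "x \<in> {..<N * k}"
    with d[of x] show "outer_shift N k x \<in> {..<N * k}"
      using block_index_less[of "Suc (x div k) mod N" N "x mod k" k] by (simp add: outer_shift_def mult.commute)
  qed
  have dm: "outer_shift N k x div k = Suc (x div k) mod N" "outer_shift N k x mod k = x mod k"
    if "x < N * k" for x using d[OF that] by (simp_all add: outer_shift_def)
  show "inj_on (outer_shift N k) {..<N * k}"
  proof (rule inj_onI)
    fix x y assume xy: "x \<in> {..<N * k}" "y \<in> {..<N * k}" "outer_shift N k x = outer_shift N k y"
    then have "x mod k = y mod k" "Suc (x div k) mod N = Suc (y div k) mod N" using dm by (metis lessThan_iff)+
    then show "x = y" using Suc_mod_inj[of "x div k" N "y div k"] d xy by (metis div_mult_mod_eq lessThan_iff)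
  qed
qed

lemma inner_shift_permutes:
  "inner_shift k ` {..<N * k} \<subseteq> {..<N * k}" "inj_on (inner_shift k) {..<N * k}"
proof -
  have d: "x div k < N" "x mod k < k" if "x < N * k" for x
    using div_less_of_less_mult[of x k N] that by (simp_all add: mult.commute)
  have s: "Suc (x mod k) mod k < k" if "x < N * k" for x using d[OF that] by (intro mod_less_divisor) simp
  show "inner_shift k ` {..<N * k} \<subseteq> {..<N * k}"
  proof (rule image_subsetI)
    fix x assume "x \<in> {..<N * k}"
    with d[of x] s[of x] show "inner_shift k x \<in> {..<N * k}"
      using block_index_less[of "x div k" N "Suc (x mod k) mod k" k] by (simp add: inner_shift_def mult.commute)
  qed
  have dm: "inner_shift k x div k = x div k" "inner_shift k x mod k = Suc (x mod k) mod k"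
    if "x < N * k" for x using d[OF that] s[OF that] by (simp_all add: inner_shift_def)
  show "inj_on (inner_shift k) {..<N * k}"
  proof (rule inj_onI)
    fix x y assume xy: "x \<in> {..<N * k}" "y \<in> {..<N * k}" "inner_shift k x = inner_shift k y"
    then have "x div k = y div k" "Suc (x mod k) mod k = Suc (y mod k) mod k" using dm by (metis lessThan_iff)+
    then show "x = y" using Suc_mod_inj[of "x mod k" k "y mod k"] d xy by (metis div_mult_mod_eq lessThan_iff)
  qed
qed

lemma perm_invariant_blocks_iff:
  "perm_invariant (N * k) \<pi> M \<longleftrightarrow>
    (\<forall>a<N. \<forall>b<N. \<forall>i<k. \<forall>j<k. M $$ (\<pi> (a * k + i), \<pi> (b * k + j)) = M $$ (a * k + i, b * k + j))"
    (is "?l \<longleftrightarrow> ?r")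
proof
  show ?r if ?l
    using that block_index_less[of _ N _ k] unfolding perm_invariant_def by (simp add: mult.commute)
  show ?l if r: ?r
    unfolding perm_invariant_def
  proof (intro allI impI)
    fix x y assume "x < N * k" "y < N * k"
    then have "x div k < N" "x mod k < k" "y div k < N" "y mod k < k"
      using div_less_of_less_mult[of x k N] div_less_of_less_mult[of y k N] by (simp_all add: mult.commute)
    then have "M $$ (\<pi> (x div k * k + x mod k), \<pi> (y div k * k + y mod k)) =
        M $$ (x div k * k + x mod k, y div k * k + y mod k)" using r by blast
    then show "M $$ (\<pi> x, \<pi> y) = M $$ (x, y)" by simp
  qed
qed

lemma block_circulant_circulant_blocks_iff:
  "block_circulant_circulant_blocks N k M \<longleftrightarrow> M \<in> carrier_mat (N * k) (N * k) \<and>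
    perm_invariant (N * k) (outer_shift N k) M \<and> perm_invariant (N * k) (inner_shift k) M"
    (is "?l \<longleftrightarrow> ?r")
proof
  assume ?l
  then obtain B where M: "M \<in> carrier_mat (N * k) (N * k)"
    and circ: "\<And>r. r < N \<Longrightarrow> perm_invariant k (\<lambda>i. Suc i mod k) (B r)"
    and B: "\<And>a b i j. a < N \<Longrightarrow> b < N \<Longrightarrow> i < k \<Longrightarrow> j < k \<Longrightarrow>
      M $$ (a * k + i, b * k + j) = B ((a + N - b) mod N) $$ (i, j)"
    unfolding block_circulant_circulant_blocks_def circulant_mat_iff by blast
  have "M $$ ((Suc a mod N) * k + i, (Suc b mod N) * k + j) = M $$ (a * k + i, b * k + j)"
    if "a < N" "b < N" "i < k" "j < k" for a b i j
    using that B[of "Suc a mod N" "Suc b mod N" i j] B[of a b i j] by (simp add: shift_difference)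
  moreover have "M $$ (a * k + Suc i mod k, b * k + Suc j mod k) = M $$ (a * k + i, b * k + j)"
    if "a < N" "b < N" "i < k" "j < k" for a b i j
    using that B[of a b "Suc i mod k" "Suc j mod k"] B[of a b i j] circ[of "(a + N - b) mod N"]
    by (simp add: perm_invariant_def)
  ultimately show ?r
    using M unfolding perm_invariant_blocks_iff by (simp add: outer_shift_def inner_shift_def)
next
  assume r: ?r
  then have M: "M \<in> carrier_mat (N * k) (N * k)"
    and outer: "\<And>a b i j. a < N \<Longrightarrow> b < N \<Longrightarrow> i < k \<Longrightarrow> j < k \<Longrightarrow>
      M $$ ((Suc a mod N) * k + i, (Suc b mod N) * k + j) = M $$ (a * k + i, b * k + j)"
    and inner: "\<And>a b i j. a < N \<Longrightarrow> b < N \<Longrightarrow> i < k \<Longrightarrow> j < k \<Longrightarrow>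
      M $$ (a * k + Suc i mod k, b * k + Suc j mod k) = M $$ (a * k + i, b * k + j)"
    unfolding perm_invariant_blocks_iff by (simp_all add: outer_shift_def inner_shift_def)
  \<comment> \<open>The generating blocks are those of the first block column. Outer invariance
    reduces every block to one of them, and inner invariance within block column 0 makes them
    circulant.\<close>
  define B where "B r = mat k k (\<lambda>(i, j). M $$ (r * k + i, j))" for r
  have "circulant_mat k (B r)" if "r < N" for r
    unfolding circulant_mat_iff
  proof
    show "B r \<in> carrier_mat k k" by (simp add: B_def)
    show "perm_invariant k (\<lambda>i. Suc i mod k) (B r)"
      using inner[of r 0] that by (auto simp: perm_invariant_def B_def)
  qed
  moreover have "M $$ (a * k + i, b * k + j) = B ((a + N - b) mod N) $$ (i, j)"
    if "a < N" "b < N" "i < k" "j < k" for a b i j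
    using shift_invariant_difference[of N "\<lambda>a b. M $$ (a * k + i, b * k + j)" a b] outer that
    by (simp add: B_def)
  ultimately show ?l
    using M unfolding block_circulant_circulant_blocks_def by blast
qed

subsection \<open>Normality\<close>

text \<open>
  With \<open>X = P\<^sup>H Q\<close>, normality of \<open>P D Q\<^sup>H\<close> says that \<open>X\<close> commutes with \<open>|D|\<^sup>2\<close>, so \<open>X\<close> vanishes
  outside the positions \<open>(i, j)\<close> with \<open>d\<^sub>i = d\<^sub>j\<close>; hence it commutes with every function of \<open>D\<close>.
\<close>

lemma normal_unitary_diagonal:
  fixes P Q D E :: "complex mat" and d :: "nat \<Rightarrow> real" and g :: "real \<Rightarrow> complex"
  assumes P: "P \<in> carrier_mat n n" "mat_adjoint P * P = 1\<^sub>m n"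
    and Q: "Q \<in> carrier_mat n n" "mat_adjoint Q * Q = 1\<^sub>m n"
    and D: "D = mat n n (\<lambda>(i, j). if i = j then complex_of_real (d i) else 0)"
    and E: "E = mat n n (\<lambda>(i, j). if i = j then g (d i) else 0)"
    and d: "\<And>i. i < n \<Longrightarrow> 0 \<le> d i"
    and normal: "mat_adjoint (P * D * mat_adjoint Q) * (P * D * mat_adjoint Q) =
      (P * D * mat_adjoint Q) * mat_adjoint (P * D * mat_adjoint Q)"
  shows "mat_adjoint (P * E * mat_adjoint Q) * (P * E * mat_adjoint Q) =
      (P * E * mat_adjoint Q) * mat_adjoint (P * E * mat_adjoint Q)"
proof -
  define diag :: "(nat \<Rightarrow> complex) \<Rightarrow> complex mat"
    where "diag h = mat n n (\<lambda>(i, j). if i = j then h i else 0)" for h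
  have diag: "diag h \<in> carrier_mat n n" for h by (simp add: diag_def)
  have diag_index: "diag h $$ (i, j) = (if i = j then h i else 0)" if "i < n" "j < n" for h i j
    using that by (simp add: diag_def)
  have diag_dim: "dim_row (diag h) = n" "dim_col (diag h) = n" for h by (simp_all add: diag_def)
  note c = P(1) Q(1) mat_adjoint_carrier[OF P(1)] mat_adjoint_carrier[OF Q(1)]
  have PP: "P * mat_adjoint P = 1\<^sub>m n" and QQ: "Q * mat_adjoint Q = 1\<^sub>m n"
    by (rule mat_mult_left_right_inverse[OF c(3,1) P(2)], rule mat_mult_left_right_inverse[OF c(4,2) Q(2)])
  have adj_diag: "mat_adjoint (diag h) = diag (\<lambda>i. cnj (h i))" for h
    by (rule eq_matI) (auto simp: diag_def)
  have mult_diag: "(X * diag h) $$ (i, j) = X $$ (i, j) * h j" "(diag h * X) $$ (i, j) = h i * X $$ (i, j)"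
    if "X \<in> carrier_mat n n" "i < n" "j < n" for X h i j
  proof -
    have "(X * diag h) $$ (i, j) = (\<Sum>r<n. if r = j then X $$ (i, r) * h r else 0)"
      unfolding index_mult_sum[OF that(1) diag that(2,3)] using that by (intro sum.cong) (auto simp: diag_def)
    then show "(X * diag h) $$ (i, j) = X $$ (i, j) * h j" using that by simp
    have "(diag h * X) $$ (i, j) = (\<Sum>r<n. if r = i then h r * X $$ (r, j) else 0)"
      unfolding index_mult_sum[OF diag that(1,2,3)] using that by (intro sum.cong) (auto simp: diag_def)
    then show "(diag h * X) $$ (i, j) = h i * X $$ (i, j)" using that by simp
  qed
  have diag_diag: "diag h * diag k = diag (\<lambda>i. h i * k i)" for h k
    by (rule eq_matI) (auto simp: mult_diag[OF diag] diag_index diag_dim simp del: index_mult_mat(1))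
  note assoc = assoc_mult_mat[of _ n n _ n _ n]
  note cancel = P(2) Q(2) PP QQ
  have cancel': "mat_adjoint P * (P * Z) = Z" "mat_adjoint Q * (Q * Z) = Z" "P * (mat_adjoint P * Z) = Z"
    "Q * (mat_adjoint Q * Z) = Z" if "Z \<in> carrier_mat n n" for Z
    by (simp_all only: assoc_mult_mat[OF c(3,1) that, symmetric] assoc_mult_mat[OF c(4,2) that, symmetric]
        assoc_mult_mat[OF c(1,3) that, symmetric] assoc_mult_mat[OF c(2,4) that, symmetric]
        cancel left_mult_one_mat[OF that])
  have mc: "X * Y \<in> carrier_mat n n" if "X \<in> carrier_mat n n" "Y \<in> carrier_mat n n" for X Y :: "complex mat"
    using that by simp
  have adj: "mat_adjoint (P * diag h * mat_adjoint Q) = Q * diag (\<lambda>i. cnj (h i)) * mat_adjoint P" for h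
    using mat_adjoint_mult[OF mc[OF P(1) diag] c(4)] mat_adjoint_mult[OF P(1) diag] c diag
    by (simp add: adj_diag assoc)
  \<comment> \<open>The inner unitary factors cancel: \<open>left\<close> retains only
    \<open>Q\<close> and \<open>right\<close> only \<open>P\<close>. Both are stated for any
    \<open>h\<close> to serve \<open>D\<close> and \<open>E\<close> alike.\<close>
  have left: "mat_adjoint (P * diag h * mat_adjoint Q) * (P * diag h * mat_adjoint Q) =
      Q * diag (\<lambda>i. cnj (h i) * h i) * mat_adjoint Q" for h
  proof -
    have "mat_adjoint (P * diag h * mat_adjoint Q) * (P * diag h * mat_adjoint Q) =
        Q * ((diag (\<lambda>i. cnj (h i)) * diag h) * mat_adjoint Q)"
      unfolding adj using c diag by (simp add: assoc mc cancel')
    then show ?thesis using c diag by (simp add: diag_diag assoc mc)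
  qed
  have right: "(P * diag h * mat_adjoint Q) * mat_adjoint (P * diag h * mat_adjoint Q) =
      P * diag (\<lambda>i. cnj (h i) * h i) * mat_adjoint P" for h
  proof -
    have "(P * diag h * mat_adjoint Q) * mat_adjoint (P * diag h * mat_adjoint Q) =
        P * ((diag h * diag (\<lambda>i. cnj (h i))) * mat_adjoint P)"
      unfolding adj using c diag by (simp add: assoc mc cancel')
    then show ?thesis using c diag by (simp add: diag_diag assoc mc mult.commute)
  qed
  define X where "X = mat_adjoint P * Q"
  have X: "X \<in> carrier_mat n n" unfolding X_def by (rule mc[OF c(3,2)])
  have D': "D = diag (\<lambda>i. complex_of_real (d i))" and E': "E = diag (\<lambda>i. g (d i))"
    by (simp_all add: D E diag_def)
  let ?d2 = "diag (\<lambda>i. cnj (complex_of_real (d i)) * complex_of_real (d i))"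
  let ?e2 = "diag (\<lambda>i. cnj (g (d i)) * g (d i))"
  have "Q * ?d2 * mat_adjoint Q = P * ?d2 * mat_adjoint P"
    using normal unfolding D' left right .
  \<comment> \<open>Multiplication by \<open>mat_adjoint P\<close> and \<open>Q\<close> turns the
    equality of two conjugates of \<open>?d2\<close> into commutation with \<open>X\<close>. For
    \<open>?e2\<close> the same step is reversed at the end.\<close>
  then have "mat_adjoint P * (Q * ?d2 * mat_adjoint Q) * Q = mat_adjoint P * (P * ?d2 * mat_adjoint P) * Q"
    by simp
  then have comm: "X * ?d2 = ?d2 * X"
    using c diag by (simp add: X_def assoc mc cancel cancel' left_mult_one_mat[OF diag] right_mult_one_mat[OF diag]
          left_mult_one_mat[OF c(3)] right_mult_one_mat[OF c(4)])
  have "X * ?e2 = ?e2 * X"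
  proof (rule eq_matI)
    fix i j assume "i < dim_row (?e2 * X)" "j < dim_col (?e2 * X)"
    then have ij: "i < n" "j < n" using X by (auto simp: diag_dim)
    have "X $$ (i, j) = 0 \<or> (d i)^2 = (d j)^2"
      using arg_cong[OF comm, of "\<lambda>M. M $$ (i, j)"] unfolding mult_diag[OF X ij]
      by (auto simp: power2_eq_square simp flip: of_real_mult)
    \<comment> \<open>Nonnegativity turns equal squares into equal entries, and then any
      \<open>g\<close> takes equal values on them.\<close>
    then have "X $$ (i, j) = 0 \<or> d i = d j" using d ij by (auto simp: power2_eq_iff_nonneg)
    then show "(X * ?e2) $$ (i, j) = (?e2 * X) $$ (i, j)"
      unfolding mult_diag[OF X ij] by auto
  qed (use X in \<open>auto simp: diag_dim\<close>)
  then have "P * (X * ?e2) * mat_adjoint Q = P * (?e2 * X) * mat_adjoint Q" by simp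
  then have "Q * ?e2 * mat_adjoint Q = P * ?e2 * mat_adjoint P"
    using c diag by (simp add: X_def assoc mc cancel cancel' left_mult_one_mat[OF diag] right_mult_one_mat[OF diag]
          left_mult_one_mat[OF c(3)] right_mult_one_mat[OF c(4)])
  then show ?thesis unfolding E' left right .
qed

section \<open>Normality of tensors through block circulants\<close>

lemma bcirc_id:
  assumes p: "0 < p"
  shows "bcirc (t_id n p) = 1\<^sub>m (n * p)"
proof (rule eq_matI)
  note c = bcirc_carrier[OF p t_id_carrier[OF p], of n]
  show "dim_row (bcirc (t_id n p)) = dim_row (1\<^sub>m (n * p))" "dim_col (bcirc (t_id n p)) = dim_col (1\<^sub>m (n * p))"
    using c by auto
  fix i j assume "i < dim_row (1\<^sub>m (n * p) :: complex mat)" "j < dim_col (1\<^sub>m (n * p) :: complex mat)"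
  then have ij: "i < n * p" "j < n * p" by auto
  note i = div_less_of_less_mult[OF ij(1)] and j = div_less_of_less_mult[OF ij(2)]
  have "(i div n + p - j div n) mod p = 0 \<longleftrightarrow> i div n = j div n"
    using i j by (auto simp: mod_less_twice)
  moreover have "(i div n = j div n \<and> i mod n = j mod n) \<longleftrightarrow> i = j" by (metis div_mult_mod_eq)
  ultimately show "bcirc (t_id n p) $$ (i, j) = 1\<^sub>m (n * p) $$ (i, j)"
    using bcirc_index[OF p t_id_carrier[OF p] ij] i j ij p
    by (auto simp: t_id_eq_const t_const_nth)
qed

lemma t_normal_iff_bcirc:
  assumes p: "0 < p" and A: "A \<in> tensor_carrier n n p"
  shows "t_normal n p A \<longleftrightarrow> mat_adjoint (bcirc A) * bcirc A = bcirc A * mat_adjoint (bcirc A)"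
proof -
  note A' = t_adjoint_carrier[OF A]
  have "t_normal n p A \<longleftrightarrow> bcirc (t_adjoint A *\<^sub>T A) = bcirc (A *\<^sub>T t_adjoint A)"
    using bcirc_inj[OF p t_prod_carrier[OF p A' A] t_prod_carrier[OF p A A']] A
    unfolding t_normal_def by metis
  then show ?thesis
    by (simp only: bcirc_mult[OF p A' A] bcirc_mult[OF p A A'] bcirc_adjoint[OF p A])
qed

text \<open>Equal singular values may lie in different Fourier blocks, so the matrix lemma is
  applied to the whole block diagonal matrix at once. This is possible because the same function
  \<open>g\<close> acts in every block.\<close>

lemma gen_fun_value_normal:
  assumes p: "0 < p" and val: "gen_fun_value n n p f A B" and normal: "t_normal n p A"
  shows "t_normal n p B"
proof -
  from val obtain U S V \<Sigma>s where svd: "t_svd n n p A U S V \<Sigma>s"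
    and B: "B = U *\<^sub>T f_hat n n p f \<Sigma>s *\<^sub>T t_adjoint V"
    unfolding gen_fun_value_def by auto
  note d = t_svdD[OF svd]
  define G where "G = dft_mat p \<otimes>\<^sub>K 1\<^sub>m n"
  have G: "G \<in> carrier_mat (n * p) (n * p)" unfolding G_def by (rule kron_one_carrier[OF dft_mat_carrier])
  have GG: "mat_adjoint G * G = 1\<^sub>m (n * p)" unfolding G_def by (rule dft_kron_unitary[OF p])
  \<comment> \<open>The diagonal of the whole matrix, indexed by block \<open>i div n\<close> and
    offset \<open>i mod n\<close>.\<close>
  define s where "s i = \<Sigma>s ! (i div n) $$ (i mod n, i mod n)" for i
  have \<Sigma>: "\<Sigma>s ! (i div n) $$ (i mod n, j mod n) = (if i mod n = j mod n then s i else 0)"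
    and s: "0 \<le> s i" if "i < n * p" "j < n * p" for i j
  proof -
    note i = div_less_of_less_mult[OF that(1)] and j = div_less_of_less_mult[OF that(2)]
    have "\<Sigma>s ! (i div n) \<in> set \<Sigma>s" using i d(5) by simp
    then have M: "\<Sigma>s ! (i div n) \<in> carrier_mat n n" "diagonal_mat (\<Sigma>s ! (i div n))"
      "\<forall>a<n. \<forall>b<n. 0 \<le> \<Sigma>s ! (i div n) $$ (a, b)"
      using svd unfolding t_svd_def by blast+
    show "\<Sigma>s ! (i div n) $$ (i mod n, j mod n) = (if i mod n = j mod n then s i else 0)"
      using M(1,2) i j unfolding diagonal_mat_def s_def by auto
    show "0 \<le> s i" using M(3) i unfolding s_def by blast
  qed
  \<comment> \<open>The condition \<open>h 0 = 0\<close> keeps the off-diagonal zeros inside each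
    block. It holds for the embedding of the reals and, thanks to the default value 0 in
    \<open>f_tilde\<close>, for \<open>g\<close>.\<close>
  have diag: "diag_block_mat (map (map_mat h) \<Sigma>s) =
      mat (n * p) (n * p) (\<lambda>(i, j). if i = j then h (s i) else 0)"
    if h: "h 0 = 0" for h :: "real \<Rightarrow> complex"
  proof (rule eq_matI)
    have sub: "set (map (map_mat h) \<Sigma>s) \<subseteq> carrier_mat n n" using d(6) by auto
    note c = diag_block_mat_carrier[OF sub]
    show "dim_row (diag_block_mat (map (map_mat h) \<Sigma>s)) =
        dim_row (mat (n * p) (n * p) (\<lambda>(i, j). if i = j then h (s i) else 0))"
      "dim_col (diag_block_mat (map (map_mat h) \<Sigma>s)) =
        dim_col (mat (n * p) (n * p) (\<lambda>(i, j). if i = j then h (s i) else 0))"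
      using c d(5) by auto
    fix i j assume "i < dim_row (mat (n * p) (n * p) (\<lambda>(i, j). if i = j then h (s i) else 0))"
      "j < dim_col (mat (n * p) (n * p) (\<lambda>(i, j). if i = j then h (s i) else 0))"
    then have ij: "i < n * p" "j < n * p" by auto
    note i = div_less_of_less_mult[OF ij(1)] and j = div_less_of_less_mult[OF ij(2)]
    have M: "\<Sigma>s ! (i div n) \<in> carrier_mat n n" using i d(5,6) by (auto dest: nth_mem)
    have "diag_block_mat (map (map_mat h) \<Sigma>s) $$ (i, j) =
        (if i div n = j div n then h (\<Sigma>s ! (i div n) $$ (i mod n, j mod n)) else 0)"
      using index_diag_block_mat[OF sub, of i j] ij i j carrier_matD[OF M] d(5) by auto
    also have "\<dots> = (if i div n = j div n \<and> i mod n = j mod n then h (s i) else 0)"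
      unfolding \<Sigma>[OF ij] using h by simp
    also have "(i div n = j div n \<and> i mod n = j mod n) \<longleftrightarrow> i = j" by (metis div_mult_mod_eq)
    finally show "diag_block_mat (map (map_mat h) \<Sigma>s) $$ (i, j) =
        mat (n * p) (n * p) (\<lambda>(i, j). if i = j then h (s i) else 0) $$ (i, j)"
      using ij by simp
  qed
  note u = bcirc_carrier[OF p t_unitaryD(1)[OF d(1)]] and v = bcirc_carrier[OF p t_unitaryD(1)[OF d(2)]]
  have sandwich: "bcirc (U *\<^sub>T X *\<^sub>T t_adjoint V) =
      (bcirc U * G) * diag_block_mat (map (map_mat h) \<Sigma>s) * mat_adjoint (bcirc V * G)"
    if X: "X \<in> tensor_carrier n n p" "bcirc X = fourier_block_diag n n p (map (map_mat h) \<Sigma>s)"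
    for X and h :: "real \<Rightarrow> complex"
  proof -
    have D: "diag_block_mat (map (map_mat h) \<Sigma>s) \<in> carrier_mat (n * p) (n * p)"
    proof -
      have "set (map (map_mat h) \<Sigma>s) \<subseteq> carrier_mat n n" using d(6) by auto
      from diag_block_mat_carrier[OF this] show ?thesis using d(5) by simp
    qed
    have "bcirc X = G * diag_block_mat (map (map_mat h) \<Sigma>s) * mat_adjoint G"
      by (simp only: X(2) fourier_block_diag_def G_def mat_adjoint_kron_one[OF dft_mat_carrier])
    moreover have "bcirc (U *\<^sub>T X *\<^sub>T t_adjoint V) = bcirc U * bcirc X * mat_adjoint (bcirc V)"
      using bcirc_mult[OF p t_prod_carrier[OF p t_unitaryD(1)[OF d(1)] X(1)] t_adjoint_carrier[OF t_unitaryD(1)[OF d(2)]]]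
        bcirc_mult[OF p t_unitaryD(1)[OF d(1)] X(1)] bcirc_adjoint[OF p t_unitaryD(1)[OF d(2)]] by simp
    ultimately show ?thesis
      using u v G D mat_adjoint_carrier[OF G] mat_adjoint_carrier[OF v]
      by (simp add: mat_adjoint_mult[OF v G] assoc_mult_mat[of _ "n * p" "n * p" _ "n * p" _ "n * p"]
          mult_carrier_mat[of _ "n * p" "n * p" _ "n * p"])
  qed
  have unitary: "mat_adjoint (bcirc Q * G) * (bcirc Q * G) = 1\<^sub>m (n * p)" "bcirc Q * G \<in> carrier_mat (n * p) (n * p)"
    if Q: "t_unitary n p Q" for Q
  proof -
    note c = bcirc_carrier[OF p t_unitaryD(1)[OF Q]]
    show "bcirc Q * G \<in> carrier_mat (n * p) (n * p)" by (rule mult_carrier_mat[OF c G])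
    have "mat_adjoint (bcirc Q) * bcirc Q = bcirc (t_id n p)"
      using bcirc_mult[OF p t_adjoint_carrier[OF t_unitaryD(1)[OF Q]] t_unitaryD(1)[OF Q]]
        bcirc_adjoint[OF p t_unitaryD(1)[OF Q]] t_unitaryD(2)[OF Q] by simp
    also have "\<dots> = 1\<^sub>m (n * p)" by (rule bcirc_id[OF p])
    finally have QQ: "mat_adjoint (bcirc Q) * bcirc Q = 1\<^sub>m (n * p)" .
    have "mat_adjoint (bcirc Q * G) * (bcirc Q * G) = mat_adjoint G * ((mat_adjoint (bcirc Q) * bcirc Q) * G)"
      using c G mat_adjoint_carrier[OF G] mat_adjoint_carrier[OF c]
      by (simp add: mat_adjoint_mult[OF c G] assoc_mult_mat[of _ "n * p" "n * p" _ "n * p" _ "n * p"]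
          mult_carrier_mat[of _ "n * p" "n * p" _ "n * p"])
    then show "mat_adjoint (bcirc Q * G) * (bcirc Q * G) = 1\<^sub>m (n * p)"
      using G GG by (simp add: QQ)
  qed
  have A_carrier: "A \<in> tensor_carrier n n p" using normal unfolding t_normal_def by simp
  define g where "g \<sigma> = (if 0 < \<sigma> then f (complex_of_real \<sigma>) else 0)" for \<sigma>
  note fh = f_hat_carrier_bcirc[OF p d(5,6), of f]
  have fh2: "bcirc (f_hat n n p f \<Sigma>s) = fourier_block_diag n n p (map (map_mat g) \<Sigma>s)"
    unfolding fh(2) by (simp add: f_tilde_def[abs_def] g_def[abs_def])
  note bA = sandwich[OF d(3,7), folded d(4)] and bB = sandwich[OF fh(1) fh2, folded B]
  show ?thesis
    unfolding t_normal_iff_bcirc[OF p gen_fun_value_carrier[OF p val]] bB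
  proof (rule normal_unitary_diagonal[OF unitary(2,1)[OF d(1)] unitary(2,1)[OF d(2)] diag diag])
    show "mat_adjoint (bcirc U * G * diag_block_mat (map (map_mat complex_of_real) \<Sigma>s) * mat_adjoint (bcirc V * G)) *
        (bcirc U * G * diag_block_mat (map (map_mat complex_of_real) \<Sigma>s) * mat_adjoint (bcirc V * G)) =
        bcirc U * G * diag_block_mat (map (map_mat complex_of_real) \<Sigma>s) * mat_adjoint (bcirc V * G) *
        mat_adjoint (bcirc U * G * diag_block_mat (map (map_mat complex_of_real) \<Sigma>s) * mat_adjoint (bcirc V * G))"
      using normal unfolding t_normal_iff_bcirc[OF p A_carrier] bA .
  qed (use s in \<open>auto simp: g_def\<close>)
qed

subsection \<open>Centrohermitian structure\<close>

text \<open>The exchange matrix is the permutation matrix of the index reversal; for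
  \<open>i < n\<close> the truncated subtraction is exact.\<close>

lemma t_exchange_eq_const: "t_exchange n p = t_const p (perm_mat n (\<lambda>i. n - 1 - i))"
proof -
  have "mat n n (\<lambda>(i, j). if i + j + 1 = n then 1 else 0) = perm_mat n (\<lambda>i. n - 1 - i)"
    by (rule eq_matI) (auto simp: perm_mat_def)
  then show ?thesis by (simp add: t_exchange_def t_const_def perm_mat_def)
qed

text \<open>The reversal is an involution. Self-adjointness lets the right factor in the definition
  of centrohermitian be read as the adjoint that the invariance lemmas ask for.\<close>

lemma t_adjoint_exchange:
  assumes "0 < p"
  shows "t_adjoint (t_exchange n p) = t_exchange n p"
proof -
  have "mat_adjoint (perm_mat n (\<lambda>i. n - 1 - i)) = perm_mat n (\<lambda>i. n - 1 - i)"
    by (rule eq_matI) (auto simp: perm_mat_def)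
  then show ?thesis by (simp add: t_exchange_eq_const t_adjoint_const[OF assms])
qed

lemma t_unitary_exchange:
  assumes "0 < p"
  shows "t_unitary n p (t_exchange n p)"
  unfolding t_exchange_eq_const
  by (rule t_unitary_const[OF assms perm_mat_carrier perm_mat_unitary]) (auto simp: inj_on_def)

section \<open>Sign changes\<close>

lemma t_uminus_carrier [simp]: "A \<in> tensor_carrier m n p \<Longrightarrow> t_uminus A \<in> tensor_carrier m n p"
  unfolding tensor_carrier_def t_uminus_def by auto

lemma t_uminus_index:
  assumes "A \<in> tensor_carrier m n p" "k < p" "i < m" "j < n"
  shows "t_uminus A ! k $$ (i, j) = - (A ! k $$ (i, j))"
  using assms tensor_carrierD(1)[OF assms(1)] tensor_dims[OF assms(1,2)] by (simp add: t_uminus_def)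

lemma t_uminus_uminus:
  assumes "A \<in> tensor_carrier m n p"
  shows "t_uminus (t_uminus A) = A"
  using assms t_uminus_index[OF t_uminus_carrier[OF assms]] t_uminus_index[OF assms]
  by (intro tensor_eqI[of _ m n p]) simp_all

lemma t_uminus_prod:
  assumes p: "0 < p" and A: "A \<in> tensor_carrier m n p" and B: "B \<in> tensor_carrier n s p"
  shows "t_uminus A *\<^sub>T B = t_uminus (A *\<^sub>T B)" "A *\<^sub>T t_uminus B = t_uminus (A *\<^sub>T B)"
proof -
  note A' = t_uminus_carrier[OF A] and B' = t_uminus_carrier[OF B]
    and AB = t_prod_carrier[OF p A B] and AB' = t_uminus_carrier[OF t_prod_carrier[OF p A B]]
  show "t_uminus A *\<^sub>T B = t_uminus (A *\<^sub>T B)"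
    by (rule tensor_eqI[OF t_prod_carrier[OF p A' B] AB'])
      (simp add: t_prod_index[OF p A' B] t_uminus_index[OF AB] t_prod_index[OF p A B] t_uminus_index[OF A] sum_negf)
  show "A *\<^sub>T t_uminus B = t_uminus (A *\<^sub>T B)"
    by (rule tensor_eqI[OF t_prod_carrier[OF p A B'] AB'])
      (simp add: t_prod_index[OF p A B'] t_uminus_index[OF AB] t_prod_index[OF p A B] t_uminus_index[OF B] sum_negf)
qed

lemma t_adjoint_uminus:
  assumes p: "0 < p" and A: "A \<in> tensor_carrier m n p"
  shows "t_adjoint (t_uminus A) = t_uminus (t_adjoint A)"
proof (rule tensor_eqI[OF t_adjoint_carrier[OF t_uminus_carrier[OF A]] t_uminus_carrier[OF t_adjoint_carrier[OF A]]])
  fix k i j assume k: "k < p" "i < n" "j < m"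
  then have "(p - k) mod p < p" by simp
  then show "t_adjoint (t_uminus A) ! k $$ (i, j) = t_uminus (t_adjoint A) ! k $$ (i, j)"
    using t_uminus_index[OF t_adjoint_carrier[OF A] k] k tensor_carrierD(1)[OF A]
      tensor_carrierD(1)[OF t_uminus_carrier[OF A]] tensor_dims[OF A] tensor_dims[OF t_uminus_carrier[OF A]]
      t_uminus_index[OF A, of "(p - k) mod p" j i]
    by (simp add: t_adjoint_def Let_def)
qed

lemma t_unitary_uminus:
  assumes p: "0 < p" and Q: "t_unitary n p Q"
  shows "t_unitary n p (t_uminus Q)"
proof -
  note c = t_unitaryD(1)[OF Q] and a = t_adjoint_carrier[OF t_unitaryD(1)[OF Q]]
  have "t_adjoint (t_uminus Q) *\<^sub>T t_uminus Q = t_adjoint Q *\<^sub>T Q"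
    "t_uminus Q *\<^sub>T t_adjoint (t_uminus Q) = Q *\<^sub>T t_adjoint Q"
    by (simp_all only: t_adjoint_uminus[OF p c] t_uminus_prod(1)[OF p a t_uminus_carrier[OF c]]
        t_uminus_prod(2)[OF p a c] t_uminus_prod(1)[OF p c t_uminus_carrier[OF a]] t_uminus_prod(2)[OF p c a]
        t_uminus_uminus[OF t_prod_carrier[OF p a c]] t_uminus_uminus[OF t_prod_carrier[OF p c a]])
  then show ?thesis using t_unitaryD[OF Q] by (simp add: t_unitary_def)
qed

lemma gen_fun_centrohermitian:
  assumes p: "0 < p" and wd: "gen_fun_well_defined m n p f A"
    and real: "\<And>\<sigma>. \<sigma> \<in> t_singular_values m n p A \<Longrightarrow> 0 < \<sigma> \<Longrightarrow> f (complex_of_real \<sigma>) \<in> \<real>"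
    and A: "centrohermitian m n p A"
  shows "centrohermitian m n p (gen_fun m n p f A)"
proof -
  have "A \<in> tensor_carrier m n p" "t_exchange m p *\<^sub>T A *\<^sub>T t_adjoint (t_exchange n p) = t_cnj A"
    using A unfolding centrohermitian_def by (simp_all add: t_adjoint_exchange[OF p])
  from gen_fun_cnj_invariant[OF p wd this(1) t_unitary_exchange[OF p] t_unitary_exchange[OF p] real this(2)]
  show ?thesis
    using gen_fun_carrier[OF p wd] unfolding centrohermitian_def by (simp add: t_adjoint_exchange[OF p])
qed

text \<open>The sign can be moved neither into the singular values, which are nonnegative, nor
  through \<open>f\<close>. It is absorbed into the left unitary: minus the exchange tensor is
  unitary, and with it \<open>A\<close> is sent to its conjugate as in the centrohermitian
  case.\<close>

lemma gen_fun_skew_centrohermitian: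
  assumes p: "0 < p" and wd: "gen_fun_well_defined m n p f A"
    and real: "\<And>\<sigma>. \<sigma> \<in> t_singular_values m n p A \<Longrightarrow> 0 < \<sigma> \<Longrightarrow> f (complex_of_real \<sigma>) \<in> \<real>"
    and skew: "skew_centrohermitian m n p A"
  shows "skew_centrohermitian m n p (gen_fun m n p f A)"
proof -
  let ?R = "t_exchange m p" and ?Q = "t_exchange n p" and ?B = "gen_fun m n p f A"
  note R = t_unitary_exchange[OF p, of m] and Q = t_unitary_exchange[OF p, of n]
  note cR = t_unitaryD(1)[OF R] and cQ = t_unitaryD(1)[OF Q] and B = gen_fun_carrier[OF p wd]
  have A: "A \<in> tensor_carrier m n p" "?R *\<^sub>T A *\<^sub>T ?Q = t_uminus (t_cnj A)"
    using skew unfolding skew_centrohermitian_def by auto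
  have uminus: "t_uminus ?R *\<^sub>T X *\<^sub>T ?Q = t_uminus (?R *\<^sub>T X *\<^sub>T ?Q)" if "X \<in> tensor_carrier m n p" for X
    using t_uminus_prod(1)[OF p cR that] t_uminus_prod(1)[OF p t_prod_carrier[OF p cR that] cQ] by simp
  have "t_uminus ?R *\<^sub>T A *\<^sub>T t_adjoint ?Q = t_cnj A"
    using uminus[OF A(1)] A t_uminus_uminus[OF t_cnj_carrier[OF A(1)]] by (simp add: t_adjoint_exchange[OF p])
  from gen_fun_cnj_invariant[OF p wd A(1) t_unitary_uminus[OF p R] Q real this]
  have "t_uminus (?R *\<^sub>T ?B *\<^sub>T ?Q) = t_cnj ?B"
    using uminus[OF B] by (simp add: t_adjoint_exchange[OF p])
  then have "?R *\<^sub>T ?B *\<^sub>T ?Q = t_uminus (t_cnj ?B)"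
    using t_uminus_uminus[OF t_prod_carrier[OF p t_prod_carrier[OF p cR B] cQ]] by metis
  then show ?thesis using B unfolding skew_centrohermitian_def by simp
qed

lemma gen_fun_F_circulant:
  assumes p: "0 < p" and wd: "gen_fun_well_defined n n p f A" and A: "F_circulant n p A"
  shows "F_circulant n p (gen_fun n n p f A)"
proof -
  have "inj_on (\<lambda>i. Suc i mod n) {..<n}" by (rule inj_onI) (auto intro: Suc_mod_inj)
  moreover have "(\<lambda>i. Suc i mod n) ` {..<n} \<subseteq> {..<n}" by auto
  ultimately show ?thesis
    using gen_fun_perm_invariant[OF p wd] A gen_fun_carrier[OF p wd]
    unfolding F_circulant_def circulant_mat_iff tensor_carrier_def by blast
qed

lemma gen_fun_F_block_circulant:
  assumes p: "0 < p" and wd: "gen_fun_well_defined m n p f A"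
    and A: "F_block_circulant_F_circulant_blocks N k m n p A"
  shows "F_block_circulant_F_circulant_blocks N k m n p (gen_fun m n p f A)"
proof -
  have Ac: "A \<in> tensor_carrier m n p"
    and bc: "\<And>X. X \<in> set A \<Longrightarrow> block_circulant_circulant_blocks N k X"
    using A unfolding F_block_circulant_F_circulant_blocks_def by auto
  \<comment> \<open>Positivity of \<open>p\<close> provides a slice. Its two sizes must agree, which
    gives \<open>m = n = N * k\<close> and makes the square permutation symmetry applicable.\<close>
  have "A ! 0 \<in> set A" using Ac p by (simp add: tensor_carrierD(1))
  then have "A ! 0 \<in> carrier_mat (N * k) (N * k)" "A ! 0 \<in> carrier_mat m n"
    using bc Ac p tensor_carrierD(2)[OF Ac p] unfolding block_circulant_circulant_blocks_iff by auto
  then have mn: "m = N * k" "n = N * k" by auto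
  note B = gen_fun_carrier[OF p wd]
  show ?thesis
    using gen_fun_perm_invariant[OF p wd[unfolded mn] Ac[unfolded mn] outer_shift_permutes]
      gen_fun_perm_invariant[OF p wd[unfolded mn] Ac[unfolded mn] inner_shift_permutes] bc B
    unfolding F_block_circulant_F_circulant_blocks_def block_circulant_circulant_blocks_iff tensor_carrier_def mn
    by blast
qed

theorem theorem9:
  fixes m n p :: nat and f :: "complex \<Rightarrow> complex" and A :: tensor
  assumes "0 < m" "0 < n" "0 < p"
    and "A \<in> tensor_carrier m n p"
    and "gen_fun_well_defined m n p f A"
  shows
    "((\<forall>\<sigma> \<in> t_singular_values m n p A. 0 < \<sigma> \<longrightarrow> f (complex_of_real \<sigma>) \<in> \<real>) \<longrightarrow>
        (centrohermitian m n p A \<longrightarrow> centrohermitian m n p (gen_fun m n p f A)) \<and>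
        (skew_centrohermitian m n p A \<longrightarrow> skew_centrohermitian m n p (gen_fun m n p f A))) \<and>
     (m = n \<longrightarrow> t_normal n p A \<longrightarrow> t_normal n p (gen_fun m n p f A)) \<and>
     (m = n \<longrightarrow> F_circulant n p A \<longrightarrow> F_circulant n p (gen_fun m n p f A)) \<and>
     (\<forall>N k. F_block_circulant_F_circulant_blocks N k m n p A \<longrightarrow>
        F_block_circulant_F_circulant_blocks N k m n p (gen_fun m n p f A))"
proof (intro conjI impI allI)
  assume real: "\<forall>\<sigma> \<in> t_singular_values m n p A. 0 < \<sigma> \<longrightarrow> f (complex_of_real \<sigma>) \<in> \<real>"
  show "centrohermitian m n p (gen_fun m n p f A)" if "centrohermitian m n p A"
    using real by (intro gen_fun_centrohermitian[OF assms(3,5) _ that]) simp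
  show "skew_centrohermitian m n p (gen_fun m n p f A)" if "skew_centrohermitian m n p A"
    using real by (intro gen_fun_skew_centrohermitian[OF assms(3,5) _ that]) simp
next
  assume "m = n"
  note wd = assms(5)[unfolded this]
  show "t_normal n p (gen_fun m n p f A)" if "t_normal n p A"
    unfolding \<open>m = n\<close> by (rule gen_fun_value_normal[OF assms(3) gen_fun_value_gen_fun[OF wd] that])
  show "F_circulant n p (gen_fun m n p f A)" if "F_circulant n p A"
    unfolding \<open>m = n\<close> by (rule gen_fun_F_circulant[OF assms(3) wd that])
next
  fix N k assume "F_block_circulant_F_circulant_blocks N k m n p A"
  then show "F_block_circulant_F_circulant_blocks N k m n p (gen_fun m n p f A)"
    by (rule gen_fun_F_block_circulant[OF assms(3,5)])
qed

end
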